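(* Let $q$ be a qubit and $B$ a circuit with $qv(B)=\{q\}$. The following equivalences hold for quantum circuits (all circuits appearing being well-formed): (1) (Symmetry) With $\mathsf X$ the NOT gate (and computational basis), $C_0\leftarrow\mathsf X[q]\rightarrow C_1\equiv C_1\leftarrow[q]\mathsf X\rightarrow C_0$. More generally, if $U$ is a unitary with $U|\varphi_i\rangle=\lambda_i|\psi_i\rangle$ for $i=0,1$, where $\{|\varphi_i\rangle\}$, $\{|\psi_i\rangle\}$ are orthonormal bases of $\mathcal H_q$, then $$C_0\stackrel{|\psi_0\rangle}{\leftarrow}U[q]\stackrel{|\psi_1\rangle}{\rightarrow}C_1\;\equiv\;C_0\stackrel{|\varphi_0\rangle}{\leftarrow}[q]U\stackrel{|\varphi_1\rangle}{\rightarrow}C_1 .$$ (2) (Sequentiality) $$(C_0\leftarrow B[q]\rightarrow C_1);(D_0\leftarrow q\rightarrow D_1)\equiv(C_0;D_0)\leftarrow B[q]\rightarrow(C_1;D_1),$$ $$(C_0\leftarrow q\rightarrow C_1);(D_0\leftarrow[q]B\rightarrow D_1)\equiv(C_0;D_0)\leftarrow[q]B\rightarrow(C_1;D_1).$$ (3) (Distributivity) If $q\notin qv(C)$, then $$C;(C_0\leftarrow B[q]\rightarrow C_1)\equiv(C;C_0)\leftarrow B[q]\rightarrow(C;C_1),\qquad (C_0\leftarrow B[q]\rightarrow C_1);C\equiv(C_0;C)\leftarrow B[q]\rightarrow(C_1;C),$$ and the same holds for post-choice (i.e. with $[q]B$ in place of $B[q]$ throughout).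
   Context: Each quantum variable $q$ has a Hilbert space $\mathcal H_q$. A register $\bar q=q_1,\dots,q_n$ is a finite sequence of distinct variables (identified with its set), with space $\mathcal H_{\bar q}=\bigotimes_i\mathcal H_{q_i}$. A set $\mathcal U$ of unitary constants is fixed (those named in the claim belong to it); $U[\bar q]$ is a basic gate when the type of $U$ matches $\bar q$. Circuits: $C::=\mathbf{skip}\mid U[\bar q]\mid C_1;C_2\mid \mathbf{qif}\,[\bar q](\square_{i=1}^d|\psi_i\rangle\to C_i)\,\mathbf{fiq}$, where (well-formedness) $\{|\psi_i\rangle\}_{i=1}^d$ is an orthonormal basis of $\mathcal H_{\bar q}$ and $\bar q\cap\bigcup_iqv(C_i)=\emptyset$; $qv(C)$ is the set of variables occurring in $C$. Semantics: $[\![C]\!]$ is the unitary on $\mathcal H_{qv(C)}$ with $[\![\mathbf{skip}]\!]=I$, $[\![U[\bar q]]\!]=U_{\bar q}$, $[\![C_1;C_2]\!]=[\![C_2]\!][\![C_1]\!]$, $[\![\mathbf{qif}\,[\bar q](\square_i|\psi_i\rangle\to C_i)\,\mathbf{fiq}]\!]=\sum_i|\psi_i\rangle_{\bar q}\langle\psi_i|\otimes[\![C_i]\!]$, operators being extended by the identity to all variables of the whole circuit. $C_1\equiv C_2$ iff $[\![C_1]\!]\otimes I_{qv(C_2)\setminus qv(C_1)}=[\![C_2]\!]\otimes I_{qv(C_1)\setminus qv(C_2)}$. For a qubit $q$ and an orthonormal basis $|\varphi_0\rangle,|\varphi_1\rangle$ of $\mathcal H_q$, $C_0\stackrel{|\varphi_0\rangle}{\leftarrow}q\stackrel{|\varphi_1\rangle}{\rightarrow}C_1$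 denotes $\mathbf{qif}\,[q](|\varphi_0\rangle\to C_0\ \square\ |\varphi_1\rangle\to C_1)\,\mathbf{fiq}$; the basis labels are dropped when the basis is fixed (e.g. computational), the same for all occurrences. Quantum choice, for a circuit $B$ with $qv(B)=\{q\}$: pre-choice $C_0\leftarrow B[q]\rightarrow C_1$ means $B;(C_0\leftarrow q\rightarrow C_1)$; post-choice $C_0\leftarrow[q]B\rightarrow C_1$ means $(C_0\leftarrow q\rightarrow C_1);B$ (similarly with basis labels; for a unitary constant $U$, the circuit $B$ is the gate $U[q]$). *)

theory Defs
  imports "HOL-Analysis.Analysis"
begin

text \<open>
  Every Hilbert space is \<open>\<ell>\<^sup>2(S)\<close> for some index set \<open>S\<close>, so a quantum variable \<open>q\<close> is given by a
  set \<open>X q\<close> of basis labels, with \<open>\<H>\<^sub>q = \<ell>\<^sup>2(X q)\<close>; no finiteness is assumed. Tensor products are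
  \<open>\<ell>\<^sup>2\<close> spaces over products of label sets, in two presentations:
  \<^item> for a sequence of types \<open>[S\<^sub>1,\<dots>,S\<^sub>n]\<close>, the label set is \<open>listset [S\<^sub>1,\<dots>,S\<^sub>n]\<close>
    (this is where unitary constants and the bases of a quantum conditional live);
  \<^item> for a set \<open>V\<close> of variables, the label set is \<open>PiE V X\<close>
    (this is where the semantics of circuits lives).
\<close>

type_synonym 'i vec = "'i \<Rightarrow> complex"
type_synonym 'i lop = "'i vec \<Rightarrow> 'i vec"

definition ell2 :: "'i set \<Rightarrow> 'i vec set" where
  "ell2 S = {f. (\<forall>x. x \<notin> S \<longrightarrow> f x = 0) \<and> (\<lambda>x. (cmod (f x))\<^sup>2) summable_on S}"

definition l2_inner :: "'i set \<Rightarrow> 'i vec \<Rightarrow> 'i vec \<Rightarrow> complex" where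
  "l2_inner S f g = (\<Sum>\<^sub>\<infinity>x\<in>S. cnj (f x) * g x)"

definition unitary_on :: "'i set \<Rightarrow> 'i lop \<Rightarrow> bool" where
  "unitary_on S A \<longleftrightarrow>
     A ` ell2 S = ell2 S \<and>
     (\<forall>f\<in>ell2 S. \<forall>g\<in>ell2 S. \<forall>a b.
        A (\<lambda>x. a * f x + b * g x) = (\<lambda>x. a * A f x + b * A g x)) \<and>
     (\<forall>f\<in>ell2 S. \<forall>g\<in>ell2 S. l2_inner S (A f) (A g) = l2_inner S f g)"

definition orthonormal_basis :: "'i set \<Rightarrow> 'i vec list \<Rightarrow> bool" where
  "orthonormal_basis S bs \<longleftrightarrow>
     set bs \<subseteq> ell2 S \<and>
     (\<forall>i<length bs. \<forall>j<length bs. l2_inner S (bs ! i) (bs ! j) = (if i = j then 1 else 0)) \<and>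
     (\<forall>f\<in>ell2 S. \<exists>c. f = (\<lambda>x. \<Sum>i<length bs. c i * (bs ! i) x))"

definition ket :: "'i \<Rightarrow> 'i vec" where
  "ket x = (\<lambda>y. if y = x then 1 else 0)"

text \<open>The rank-one operator \<open>|\<psi>\<rangle>\<langle>\<psi>|\<close>.\<close>
definition ketbra :: "'i set \<Rightarrow> 'i vec \<Rightarrow> 'i lop" where
  "ketbra S \<psi> f = (\<lambda>x. \<psi> x * l2_inner S \<psi> f)"

text \<open>A unitary constant carries its type, the list of label sets of the spaces it acts on.\<close>
datatype 'b uconst = UConst (utype: "'b set list") (uop: "'b list lop")

definition unitary_constants :: "'b uconst set \<Rightarrow> bool" where
  "unitary_constants \<U> \<longleftrightarrow> (\<forall>U\<in>\<U>. unitary_on (listset (utype U)) (uop U))"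

datatype ('q, 'b) circuit =
    Skip
  | Gate "'b uconst" "'q list"
  | Seq "('q, 'b) circuit" "('q, 'b) circuit"
  | QIf "'q list" "('b list vec \<times> ('q, 'b) circuit) list"

fun qv :: "('q, 'b) circuit \<Rightarrow> 'q set" where
  "qv Skip = {}"
| "qv (Gate U qs) = set qs"
| "qv (Seq C D) = qv C \<union> qv D"
| "qv (QIf qs bs) = set qs \<union> (\<Union>(\<psi>, C)\<in>set bs. qv C)"

fun well_formed :: "('q \<Rightarrow> 'b set) \<Rightarrow> 'b uconst set \<Rightarrow> ('q, 'b) circuit \<Rightarrow> bool" where
  "well_formed X \<U> Skip \<longleftrightarrow> True"
| "well_formed X \<U> (Gate U qs) \<longleftrightarrow> U \<in> \<U> \<and> distinct qs \<and> utype U = map X qs"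
| "well_formed X \<U> (Seq C D) \<longleftrightarrow> well_formed X \<U> C \<and> well_formed X \<U> D"
| "well_formed X \<U> (QIf qs bs) \<longleftrightarrow>
     distinct qs \<and>
     orthonormal_basis (listset (map X qs)) (map fst bs) \<and>
     set qs \<inter> (\<Union>(\<psi>, C)\<in>set bs. qv C) = {} \<and>
     (\<forall>(\<psi>, C)\<in>set bs. well_formed X \<U> C)"

definition assign :: "'q list \<Rightarrow> 'b list \<Rightarrow> 'q \<Rightarrow> 'b" where
  "assign qs xs = (\<lambda>v\<in>set qs. the (map_of (zip qs xs) v))"

text \<open>
  Transport of an operator from the space of tuples over \<open>map X qs\<close> to the space of the variable
  set \<open>set qs\<close>, along the bijection \<open>s \<mapsto> map s qs\<close> of labels, whose inverse is \<open>assign qs\<close>.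
\<close>
definition on_register :: "('q \<Rightarrow> 'b set) \<Rightarrow> 'q list \<Rightarrow> 'b list lop \<Rightarrow> ('q \<Rightarrow> 'b) lop" where
  "on_register X qs A f = (\<lambda>s.
     if s \<in> PiE (set qs) X
     then A (\<lambda>xs. if xs \<in> listset (map X qs) then f (assign qs xs) else 0) (map s qs)
     else 0)"

text \<open>
  For an operator \<open>A\<close> on the space of \<open>W\<close> and \<open>Z\<close> disjoint from \<open>W\<close>, the operator \<open>A \<otimes> I\<^sub>Z\<close>
  on the space of \<open>W \<union> Z\<close>: apply \<open>A\<close> to the slice of the vector with the labels on \<open>Z\<close> held fixed.
\<close>
definition tensor_id ::
  "('q \<Rightarrow> 'b set) \<Rightarrow> 'q set \<Rightarrow> 'q set \<Rightarrow> ('q \<Rightarrow> 'b) lop \<Rightarrow> ('q \<Rightarrow> 'b) lop" where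
  "tensor_id X W Z A f = (\<lambda>s.
     if s \<in> PiE (W \<union> Z) X
     then A (\<lambda>t. if t \<in> PiE W X then f (override_on s t W) else 0) (restrict s W)
     else 0)"

text \<open>\<open>sem X C\<close> is an operator on the space of \<open>qv C\<close>.\<close>
fun sem :: "('q \<Rightarrow> 'b set) \<Rightarrow> ('q, 'b) circuit \<Rightarrow> ('q \<Rightarrow> 'b) lop" where
  "sem X Skip = (\<lambda>f. f)"
| "sem X (Gate U qs) = on_register X qs (uop U)"
| "sem X (Seq C D) =
     tensor_id X (qv D) (qv C - qv D) (sem X D) \<circ> tensor_id X (qv C) (qv D - qv C) (sem X C)"
| "sem X (QIf qs bs) = (\<lambda>f s. \<Sum>(\<psi>, C)\<leftarrow>bs.
     tensor_id X (set qs) (qv (QIf qs bs) - set qs)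
       (on_register X qs (ketbra (listset (map X qs)) \<psi>))
       (tensor_id X (qv C) (qv (QIf qs bs) - qv C) (sem X C) f) s)"

definition circuit_equiv ::
  "('q \<Rightarrow> 'b set) \<Rightarrow> ('q, 'b) circuit \<Rightarrow> ('q, 'b) circuit \<Rightarrow> bool" where
  "circuit_equiv X C D \<longleftrightarrow>
     (\<forall>f\<in>ell2 (PiE (qv C \<union> qv D) X).
        tensor_id X (qv C) (qv D - qv C) (sem X C) f = tensor_id X (qv D) (qv C - qv D) (sem X D) f)"

text \<open>A qubit has the labels \<open>0\<close> and \<open>1\<close>; as a one-element register its computational basis is
  \<open>ket [0]\<close>, \<open>ket [1]\<close>.\<close>
definition qubit :: "('q \<Rightarrow> 'b::zero_neq_one set) \<Rightarrow> 'q \<Rightarrow> bool" where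
  "qubit X q \<longleftrightarrow> X q = {0, 1}"

definition NOT_gate :: "'b::zero_neq_one uconst" where
  "NOT_gate = UConst [{0, 1}]
     (\<lambda>f xs. if xs = [0] then f [1] else if xs = [1] then f [0] else 0)"

definition choice ::
  "'q \<Rightarrow> 'b list vec \<Rightarrow> 'b list vec \<Rightarrow> ('q, 'b) circuit \<Rightarrow> ('q, 'b) circuit \<Rightarrow> ('q, 'b) circuit" where
  "choice q \<phi>0 \<phi>1 C0 C1 = QIf [q] [(\<phi>0, C0), (\<phi>1, C1)]"

definition pre_choice ::
  "('q, 'b) circuit \<Rightarrow> 'q \<Rightarrow> 'b list vec \<Rightarrow> 'b list vec \<Rightarrow>
   ('q, 'b) circuit \<Rightarrow> ('q, 'b) circuit \<Rightarrow> ('q, 'b) circuit" where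
  "pre_choice B q \<phi>0 \<phi>1 C0 C1 = Seq B (choice q \<phi>0 \<phi>1 C0 C1)"

definition post_choice ::
  "('q, 'b) circuit \<Rightarrow> 'q \<Rightarrow> 'b list vec \<Rightarrow> 'b list vec \<Rightarrow>
   ('q, 'b) circuit \<Rightarrow> ('q, 'b) circuit \<Rightarrow> ('q, 'b) circuit" where
  "post_choice B q \<phi>0 \<phi>1 C0 C1 = Seq (choice q \<phi>0 \<phi>1 C0 C1) B"

end

theory Submission
  imports Defs
begin

text \<open>
  Extend all circuits to the space of a common variable set \<open>V\<close>. There \<open>choice q\<close> acts as
  \<open>P\<^sub>0 C\<^sub>0 + P\<^sub>1 C\<^sub>1\<close>, where \<open>P\<^sub>i\<close> projects \<open>q\<close> onto the \<open>i\<close>-th basis vector. Every circuit without \<open>q\<close>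
  commutes with every operator on \<open>q\<close>, so sequentiality reduces to \<open>P\<^sub>i P\<^sub>j = \<delta>\<^sub>i\<^sub>j P\<^sub>i\<close>, distributivity to
  linearity, and symmetry to \<open>U |\<phi>\<^sub>i\<rangle>\<langle>\<phi>\<^sub>i| = |\<psi>\<^sub>i\<rangle>\<langle>\<psi>\<^sub>i| U\<close>. Operators are only known to be linear on
  square-summable vectors, so the semantics must be shown to preserve square-summability, for
  which boundedness, stable under the partial tensor product and under sums, is the right invariant.
\<close>

section \<open>Square-summable vectors and the Cauchy-Schwarz inequality\<close>

definition sqnorm :: "'i set \<Rightarrow> 'i vec \<Rightarrow> real" where
  "sqnorm S f = (\<Sum>\<^sub>\<infinity>x\<in>S. (cmod (f x))\<^sup>2)"

text \<open>A divergent infinite sum has value 0, so a bound on \<open>sqnorm\<close> is informative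
  only together with membership in \<open>ell2\<close>; hence both are required.\<close>

definition bounded_op :: "'i set \<Rightarrow> 'i lop \<Rightarrow> bool" where
  "bounded_op S A \<longleftrightarrow>
     (\<forall>f\<in>ell2 S. \<forall>g\<in>ell2 S. \<forall>a b.
        A (\<lambda>x. a * f x + b * g x) = (\<lambda>x. a * A f x + b * A g x)) \<and>
     (\<exists>K. \<forall>f\<in>ell2 S. A f \<in> ell2 S \<and> sqnorm S (A f) \<le> K * sqnorm S f)"

lemma ell2_support: "f \<in> ell2 S \<Longrightarrow> x \<notin> S \<Longrightarrow> f x = 0"
  by (simp add: ell2_def)

lemma ell2_summable: "f \<in> ell2 S \<Longrightarrow> (\<lambda>x. (cmod (f x))\<^sup>2) summable_on S"
  by (simp add: ell2_def)

lemma sqnorm_nonneg: "0 \<le> sqnorm S f"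
  by (simp add: sqnorm_def infsum_nonneg)

lemma ell2_finite: "finite S \<Longrightarrow> ell2 S = {f. \<forall>x. x \<notin> S \<longrightarrow> f x = 0}"
  by (auto simp: ell2_def)

lemma zero_in_ell2: "(\<lambda>x. 0) \<in> ell2 S"
  by (simp add: ell2_def)

lemma ell2_scale:
  assumes "f \<in> ell2 S"
  shows "(\<lambda>x. a * f x) \<in> ell2 S" "sqnorm S (\<lambda>x. a * f x) = (cmod a)\<^sup>2 * sqnorm S f"
  using assms
  by (auto simp: ell2_def sqnorm_def norm_mult power_mult_distrib infsum_cmult_right'
      intro: summable_on_cmult_right)

text \<open>Pointwise, the square of a sum is at most twice the sum of the squares. The factor 2 is
  harmless because only the existence of some bound matters.\<close>

lemma ell2_add:
  assumes "f \<in> ell2 S" "g \<in> ell2 S"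
  shows "(\<lambda>x. f x + g x) \<in> ell2 S"
    "sqnorm S (\<lambda>x. f x + g x) \<le> 2 * sqnorm S f + 2 * sqnorm S g"
proof -
  let ?h = "\<lambda>x. 2 * (cmod (f x))\<^sup>2 + 2 * (cmod (g x))\<^sup>2"
  have le: "(cmod (f x + g x))\<^sup>2 \<le> ?h x" for x
  proof -
    have "(cmod (f x + g x))\<^sup>2 \<le> (cmod (f x) + cmod (g x))\<^sup>2"
      by (simp add: norm_triangle_ineq power_mono)
    also have "\<dots> \<le> ?h x"
      using sum_squares_bound[of "cmod (f x)" "cmod (g x)"] by (simp add: power2_sum)
    finally show ?thesis .
  qed
  have h: "?h summable_on S"
    using assms by (intro summable_on_add summable_on_cmult_right ell2_summable)
  have s: "(\<lambda>x. (cmod (f x + g x))\<^sup>2) summable_on S"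
    using summable_on_comparison_test[OF h] le by auto
  then show "(\<lambda>x. f x + g x) \<in> ell2 S"
    using assms by (auto simp: ell2_def)
  have "sqnorm S (\<lambda>x. f x + g x) \<le> infsum ?h S"
    unfolding sqnorm_def using s h le by (intro infsum_mono)
  also have "\<dots> = 2 * sqnorm S f + 2 * sqnorm S g"
    unfolding sqnorm_def using assms
    by (subst infsum_add) (auto intro!: summable_on_cmult_right ell2_summable simp: infsum_cmult_right')
  finally show "sqnorm S (\<lambda>x. f x + g x) \<le> 2 * sqnorm S f + 2 * sqnorm S g" .
qed

lemma ell2_sum:
  "finite I \<Longrightarrow> (\<And>i. i \<in> I \<Longrightarrow> f i \<in> ell2 S) \<Longrightarrow> (\<lambda>x. \<Sum>i\<in>I. f i x) \<in> ell2 S"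
  by (induction I rule: finite_induct) (auto intro: ell2_add zero_in_ell2)

text \<open>The finite inequality for \<open>L2_set\<close> bounds all partial sums of moduli by one
  constant, which yields absolute convergence and then the bound for the whole sum.\<close>

lemma cauchy_schwarz:
  assumes "f \<in> ell2 S" "g \<in> ell2 S"
  shows "(\<lambda>x. cnj (f x) * g x) summable_on S"
    "(cmod (l2_inner S f g))\<^sup>2 \<le> sqnorm S f * sqnorm S g"
proof -
  let ?p = "\<lambda>x. cnj (f x) * g x"
  let ?K = "sqrt (sqnorm S f) * sqrt (sqnorm S g)"
  have fin: "(\<Sum>x\<in>F. norm (?p x)) \<le> ?K" if F: "finite F" "F \<subseteq> S" for F
  proof -
    have L2: "L2_set (\<lambda>x. cmod (h x)) F \<le> sqrt (sqnorm S h)" if "h \<in> ell2 S" for h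
      unfolding L2_set_def sqnorm_def
      using finite_sum_le_infsum[OF ell2_summable[OF that] F] by simp
    have "(\<Sum>x\<in>F. norm (?p x)) = (\<Sum>x\<in>F. \<bar>cmod (f x)\<bar> * \<bar>cmod (g x)\<bar>)"
      by (simp add: norm_mult)
    also have "\<dots> \<le> L2_set (\<lambda>x. cmod (f x)) F * L2_set (\<lambda>x. cmod (g x)) F"
      by (rule L2_set_mult_ineq)
    also have "\<dots> \<le> ?K"
      using L2[OF assms(1)] L2[OF assms(2)] by (intro mult_mono) (auto simp: sqnorm_nonneg)
    finally show ?thesis .
  qed
  have abs: "(\<lambda>x. norm (?p x)) summable_on S"
    by (rule nonneg_bdd_above_summable_on) (use fin in \<open>auto intro!: bdd_aboveI2[where M = ?K]\<close>)
  then show "?p summable_on S"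
    by (rule abs_summable_summable)
  have "cmod (l2_inner S f g) \<le> ?K"
    unfolding l2_inner_def
    using norm_infsum_bound[OF abs] infsum_le_finite_sums[OF abs fin] by linarith
  then have "(cmod (l2_inner S f g))\<^sup>2 \<le> ?K\<^sup>2"
    by (simp add: power_mono)
  then show "(cmod (l2_inner S f g))\<^sup>2 \<le> sqnorm S f * sqnorm S g"
    by (simp add: power_mult_distrib sqnorm_nonneg)
qed

lemma l2_inner_lincomb:
  assumes "h \<in> ell2 S" "f \<in> ell2 S" "g \<in> ell2 S"
  shows "l2_inner S h (\<lambda>x. a * f x + b * g x) = a * l2_inner S h f + b * l2_inner S h g"
proof -
  have "l2_inner S h (\<lambda>x. a * f x + b * g x)
      = (\<Sum>\<^sub>\<infinity>x\<in>S. a * (cnj (h x) * f x) + b * (cnj (h x) * g x))"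
    unfolding l2_inner_def by (simp add: algebra_simps)
  also have "\<dots> = a * l2_inner S h f + b * l2_inner S h g"
    unfolding l2_inner_def using cauchy_schwarz(1) assms
    by (subst infsum_add) (auto intro!: summable_on_cmult_right simp: infsum_cmult_right')
  finally show ?thesis .
qed

lemma l2_inner_scale: "l2_inner S h (\<lambda>x. f x * c) = l2_inner S h f * c"
  unfolding l2_inner_def by (simp add: infsum_cmult_left' flip: mult.assoc)

lemma l2_inner_self:
  assumes "f \<in> ell2 S"
  shows "l2_inner S f f = of_real (sqnorm S f)"
proof -
  have "((\<lambda>x. complex_of_real ((cmod (f x))\<^sup>2)) has_sum of_real (sqnorm S f)) S"
    using ell2_summable[OF assms] unfolding sqnorm_def has_sum_of_real_iff by simp
  then have "((\<lambda>x. cnj (f x) * f x) has_sum of_real (sqnorm S f)) S"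
    by (simp add: mult.commute flip: complex_norm_square)
  then show ?thesis
    unfolding l2_inner_def by (rule infsumI)
qed

section \<open>Closure properties of bounded operators\<close>

lemma bounded_op_lincomb:
  "bounded_op S A \<Longrightarrow> f \<in> ell2 S \<Longrightarrow> g \<in> ell2 S \<Longrightarrow>
     A (\<lambda>x. a * f x + b * g x) = (\<lambda>x. a * A f x + b * A g x)"
  by (simp add: bounded_op_def)

lemma bounded_op_scale:
  "bounded_op S A \<Longrightarrow> f \<in> ell2 S \<Longrightarrow> A (\<lambda>x. a * f x) = (\<lambda>x. a * A f x)"
  using bounded_op_lincomb[of S A f f a 0] by simp

lemma bounded_op_add:
  "bounded_op S A \<Longrightarrow> f \<in> ell2 S \<Longrightarrow> g \<in> ell2 S \<Longrightarrow>
     A (\<lambda>x. f x + g x) = (\<lambda>x. A f x + A g x)"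
  using bounded_op_lincomb[of S A f g 1 1] by simp

lemma bounded_op_zero: "bounded_op S A \<Longrightarrow> A (\<lambda>x. 0) = (\<lambda>x. 0)"
  using bounded_op_scale[of S A "\<lambda>x. 0" 0] by (simp add: zero_in_ell2)

lemma bounded_op_sum:
  assumes A: "bounded_op S A" and "finite I" and "\<And>i. i \<in> I \<Longrightarrow> f i \<in> ell2 S"
  shows "A (\<lambda>x. \<Sum>i\<in>I. c i * f i x) = (\<lambda>x. \<Sum>i\<in>I. c i * A (f i) x)"
  using assms(2,3)
proof (induction I rule: finite_induct)
  case (insert i I)
  then have "(\<lambda>x. \<Sum>i\<in>I. c i * f i x) \<in> ell2 S"
    by (intro ell2_sum ell2_scale) auto
  then show ?case
    using insert bounded_op_lincomb[OF A, of "f i" "\<lambda>x. \<Sum>i\<in>I. c i * f i x" "c i" 1] by simp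
qed (simp add: bounded_op_zero[OF A])

lemma bounded_op_ell2: "bounded_op S A \<Longrightarrow> f \<in> ell2 S \<Longrightarrow> A f \<in> ell2 S"
  by (auto simp: bounded_op_def)

text \<open>A nonnegative constant is what chaining bounds in a composition requires; passing to
  \<open>max K 0\<close> only weakens the inequality.\<close>

lemma bounded_op_boundE:
  assumes "bounded_op S A"
  obtains K where "0 \<le> K" "\<And>f. f \<in> ell2 S \<Longrightarrow> sqnorm S (A f) \<le> K * sqnorm S f"
proof -
  obtain K where K: "sqnorm S (A f) \<le> K * sqnorm S f" if "f \<in> ell2 S" for f
    using assms unfolding bounded_op_def by blast
  have "K * sqnorm S f \<le> max K 0 * sqnorm S f" for f
    by (simp add: mult_right_mono sqnorm_nonneg)
  with K have "sqnorm S (A f) \<le> max K 0 * sqnorm S f" if "f \<in> ell2 S" for f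
    using that by (meson order_trans)
  then show thesis
    using that[of "max K 0"] by simp
qed

lemma bounded_opI:
  assumes "\<And>f g a b. f \<in> ell2 S \<Longrightarrow> g \<in> ell2 S \<Longrightarrow>
      A (\<lambda>x. a * f x + b * g x) = (\<lambda>x. a * A f x + b * A g x)"
    and "\<And>f. f \<in> ell2 S \<Longrightarrow> A f \<in> ell2 S"
    and "\<And>f. f \<in> ell2 S \<Longrightarrow> sqnorm S (A f) \<le> K * sqnorm S f"
  shows "bounded_op S A"
  using assms unfolding bounded_op_def by blast

lemma bounded_op_id: "bounded_op S (\<lambda>f. f)"
  by (rule bounded_opI[where K = 1]) auto

lemma bounded_op_comp:
  assumes A: "bounded_op S A" and B: "bounded_op S B"
  shows "bounded_op S (\<lambda>f. A (B f))"
proof -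
  obtain K where K: "0 \<le> K" "\<And>f. f \<in> ell2 S \<Longrightarrow> sqnorm S (A f) \<le> K * sqnorm S f"
    using bounded_op_boundE[OF A] by blast
  obtain L where L: "\<And>f. f \<in> ell2 S \<Longrightarrow> sqnorm S (B f) \<le> L * sqnorm S f"
    using bounded_op_boundE[OF B] by blast
  show ?thesis
  proof (rule bounded_opI)
    fix f assume f: "f \<in> ell2 S"
    have "sqnorm S (A (B f)) \<le> K * sqnorm S (B f)"
      using K bounded_op_ell2[OF B f] by blast
    also have "\<dots> \<le> K * (L * sqnorm S f)"
      using L[OF f] K by (intro mult_left_mono)
    finally show "sqnorm S (A (B f)) \<le> K * L * sqnorm S f"
      by simp
    show "A (B f) \<in> ell2 S"
      by (rule bounded_op_ell2[OF A bounded_op_ell2[OF B f]])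
  next
    fix f g a b assume fg: "f \<in> ell2 S" "g \<in> ell2 S"
    show "A (B (\<lambda>x. a * f x + b * g x)) = (\<lambda>x. a * A (B f) x + b * A (B g) x)"
      unfolding bounded_op_lincomb[OF B fg]
      by (rule bounded_op_lincomb[OF A bounded_op_ell2[OF B fg(1)] bounded_op_ell2[OF B fg(2)]])
  qed
qed

lemma bounded_op_plus:
  assumes A: "bounded_op S A" and B: "bounded_op S B"
  shows "bounded_op S (\<lambda>f x. A f x + B f x)"
proof -
  obtain K where K: "\<And>f. f \<in> ell2 S \<Longrightarrow> sqnorm S (A f) \<le> K * sqnorm S f"
    using bounded_op_boundE[OF A] by blast
  obtain L where L: "\<And>f. f \<in> ell2 S \<Longrightarrow> sqnorm S (B f) \<le> L * sqnorm S f"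
    using bounded_op_boundE[OF B] by blast
  show ?thesis
  proof (rule bounded_opI)
    fix f assume f: "f \<in> ell2 S"
    note add = ell2_add[OF bounded_op_ell2[OF A f] bounded_op_ell2[OF B f]]
    show "(\<lambda>x. A f x + B f x) \<in> ell2 S"
      by (rule add)
    have "sqnorm S (\<lambda>x. A f x + B f x) \<le> 2 * sqnorm S (A f) + 2 * sqnorm S (B f)"
      by (rule add)
    also have "\<dots> \<le> (2 * K + 2 * L) * sqnorm S f"
      using K[OF f] L[OF f] by (simp add: algebra_simps)
    finally show "sqnorm S (\<lambda>x. A f x + B f x) \<le> (2 * K + 2 * L) * sqnorm S f" .
  next
    fix f g a b assume fg: "f \<in> ell2 S" "g \<in> ell2 S"
    show "(\<lambda>x. A (\<lambda>x. a * f x + b * g x) x + B (\<lambda>x. a * f x + b * g x) x)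
        = (\<lambda>x. a * (A f x + B f x) + b * (A g x + B g x))"
      unfolding bounded_op_lincomb[OF A fg] bounded_op_lincomb[OF B fg] by (simp add: algebra_simps)
  qed
qed

lemma bounded_op_sum_list:
  assumes "\<And>p. p \<in> set ps \<Longrightarrow> bounded_op S (F p)"
  shows "bounded_op S (\<lambda>f x. \<Sum>p\<leftarrow>ps. F p f x)"
  using assms
proof (induction ps)
  case Nil
  show ?case
    by (rule bounded_opI[where K = 0]) (auto simp: zero_in_ell2 sqnorm_def)
next
  case (Cons p ps)
  then show ?case
    using bounded_op_plus[of S "F p" "\<lambda>f x. \<Sum>p\<leftarrow>ps. F p f x"] by simp
qed

lemma bounded_op_unitary:
  assumes "unitary_on S A"
  shows "bounded_op S A"
proof (rule bounded_opI[where K = 1])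
  fix f assume f: "f \<in> ell2 S"
  then have "A f \<in> ell2 S" "l2_inner S (A f) (A f) = l2_inner S f f"
    using assms by (auto simp: unitary_on_def)
  then show "sqnorm S (A f) \<le> 1 * sqnorm S f"
    using f by (simp add: l2_inner_self)
qed (use assms in \<open>auto simp: unitary_on_def\<close>)

text \<open>The image is a multiple of \<open>\<psi>\<close> whose coefficient is controlled by
  Cauchy-Schwarz; this makes the square of \<open>sqnorm S \<psi>\<close> a valid constant.\<close>

lemma bounded_op_ketbra:
  assumes "\<psi> \<in> ell2 S"
  shows "bounded_op S (ketbra S \<psi>)"
proof (rule bounded_opI[where K = "sqnorm S \<psi> * sqnorm S \<psi>"])
  fix f assume f: "f \<in> ell2 S"
  have eq: "ketbra S \<psi> f = (\<lambda>x. l2_inner S \<psi> f * \<psi> x)"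
    by (simp add: ketbra_def mult.commute)
  show "ketbra S \<psi> f \<in> ell2 S"
    using assms by (simp add: eq ell2_scale)
  have "sqnorm S (ketbra S \<psi> f) = (cmod (l2_inner S \<psi> f))\<^sup>2 * sqnorm S \<psi>"
    using assms by (simp add: eq ell2_scale)
  also have "\<dots> \<le> (sqnorm S \<psi> * sqnorm S f) * sqnorm S \<psi>"
    using assms f by (intro mult_right_mono cauchy_schwarz sqnorm_nonneg)
  finally show "sqnorm S (ketbra S \<psi> f) \<le> sqnorm S \<psi> * sqnorm S \<psi> * sqnorm S f"
    by (simp add: mult_ac)
qed (use assms in \<open>auto simp: ketbra_def l2_inner_lincomb algebra_simps\<close>)

section \<open>Registers: tuples of labels and labellings of variables\<close>

lemma listset_iff: "xs \<in> listset As \<longleftrightarrow> list_all2 (\<in>) xs As"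
  by (induction As arbitrary: xs) (auto simp: set_Cons_def list_all2_Cons2)

lemma map_in_listset: "s \<in> PiE (set qs) X \<Longrightarrow> map s qs \<in> listset (map X qs)"
  by (auto simp: listset_iff list_all2_map1 list_all2_map2 list_all2_same)

text \<open>Distinct variables make the lookup in the zipped list return the entry at the variable's
  own position rather than at an earlier one.\<close>

lemma map_assign:
  assumes "distinct qs" "length xs = length qs"
  shows "map (assign qs xs) qs = xs"
proof (rule nth_equalityI)
  fix i assume "i < length (map (assign qs xs) qs)"
  then show "map (assign qs xs) qs ! i = xs ! i"
    using assms map_of_zip_nth[of qs xs i] by (simp add: assign_def)
qed (use assms in simp)

lemma listset_length: "xs \<in> listset (map X qs) \<Longrightarrow> length xs = length qs"
  by (auto simp: listset_iff dest: list_all2_lengthD)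

lemma assign_in_PiE:
  assumes "distinct qs" "xs \<in> listset (map X qs)"
  shows "assign qs xs \<in> PiE (set qs) X"
proof (rule PiE_I)
  fix v assume "v \<in> set qs"
  then obtain i where i: "i < length qs" "v = qs ! i"
    by (auto simp: in_set_conv_nth)
  then have "assign qs xs v = xs ! i"
    using map_assign[OF assms(1) listset_length[OF assms(2)]] by (metis nth_map)
  then show "assign qs xs v \<in> X v"
    using assms(2) i by (auto simp: listset_iff list_all2_conv_all_nth)
qed (simp add: assign_def)

lemma assign_map:
  assumes "distinct qs" "s \<in> PiE (set qs) X"
  shows "assign qs (map s qs) = s"
proof
  fix v
  show "assign qs (map s qs) v = s v"
  proof (cases "v \<in> set qs")
    case True
    then obtain i where "i < length qs" "v = qs ! i"
      by (auto simp: in_set_conv_nth)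
    then show ?thesis
      using map_assign[OF assms(1), of "map s qs"] by (metis length_map nth_map)
  qed (use assms in \<open>auto simp: assign_def\<close>)
qed

text \<open>Together with its inverse below, this reindexes sums, so that transport between tuples
  and labellings preserves norms.\<close>

lemma bij_betw_assign:
  assumes "distinct qs"
  shows "bij_betw (assign qs) (listset (map X qs)) (PiE (set qs) X)"
  by (rule bij_betwI[where g = "\<lambda>s. map s qs"])
    (use assms in \<open>auto simp: assign_in_PiE map_in_listset assign_map map_assign listset_length\<close>)

lemma bij_betw_map_register:
  assumes "distinct qs"
  shows "bij_betw (\<lambda>s. map s qs) (PiE (set qs) X) (listset (map X qs))"
  by (rule bij_betwI[where g = "assign qs"])
    (use assms in \<open>auto simp: assign_in_PiE map_in_listset assign_map map_assign listset_length\<close>)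

text \<open>The vector that \<open>on_register\<close> hands to its operator; the default 0 outside
  the label set meets the support condition of \<open>ell2\<close>.\<close>

definition tuple_vec :: "('q \<Rightarrow> 'b set) \<Rightarrow> 'q list \<Rightarrow> ('q \<Rightarrow> 'b) vec \<Rightarrow> 'b list vec" where
  "tuple_vec X qs f = (\<lambda>xs. if xs \<in> listset (map X qs) then f (assign qs xs) else 0)"

lemma on_register_eq:
  "on_register X qs A f =
     (\<lambda>s. if s \<in> PiE (set qs) X then A (tuple_vec X qs f) (map s qs) else 0)"
  unfolding on_register_def tuple_vec_def ..

lemma tuple_vec_ell2:
  assumes "distinct qs" "f \<in> ell2 (PiE (set qs) X)"
  shows "tuple_vec X qs f \<in> ell2 (listset (map X qs))"
    "sqnorm (listset (map X qs)) (tuple_vec X qs f) = sqnorm (PiE (set qs) X) f"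
proof -
  note bij = bij_betw_assign[OF assms(1), of X]
  have "(\<lambda>xs. (cmod (f (assign qs xs)))\<^sup>2) summable_on listset (map X qs)"
    using summable_on_reindex_bij_betw[OF bij, of "\<lambda>s. (cmod (f s))\<^sup>2"] ell2_summable[OF assms(2)]
    by simp
  then show "tuple_vec X qs f \<in> ell2 (listset (map X qs))"
    by (auto simp: ell2_def tuple_vec_def cong: summable_on_cong)
  show "sqnorm (listset (map X qs)) (tuple_vec X qs f) = sqnorm (PiE (set qs) X) f"
    using infsum_reindex_bij_betw[OF bij, of "\<lambda>s. (cmod (f s))\<^sup>2"]
    by (simp add: sqnorm_def tuple_vec_def cong: infsum_cong)
qed

text \<open>Pulling back undoes the transport of the output. Since \<open>tuple_vec\<close> cuts off
  outside the label set, the output of \<open>A\<close> must already vanish there.\<close>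

lemma tuple_vec_on_register:
  assumes "distinct qs" "\<And>xs. xs \<notin> listset (map X qs) \<Longrightarrow> A (tuple_vec X qs f) xs = 0"
  shows "tuple_vec X qs (on_register X qs A f) = A (tuple_vec X qs f)"
  using assms
  by (auto simp: fun_eq_iff on_register_eq tuple_vec_def[of _ _ "\<lambda>s. _ s"] assign_in_PiE map_assign
      listset_length)

lemma bounded_op_on_register:
  assumes qs: "distinct qs" and A: "bounded_op (listset (map X qs)) A"
  shows "bounded_op (PiE (set qs) X) (on_register X qs A)"
proof -
  let ?S = "PiE (set qs) X" and ?L = "listset (map X qs)"
  obtain K where K: "\<And>f. f \<in> ell2 ?L \<Longrightarrow> sqnorm ?L (A f) \<le> K * sqnorm ?L f"
    using bounded_op_boundE[OF A] by blast
  note bij = bij_betw_map_register[OF qs, of X]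
  show ?thesis
  proof (rule bounded_opI)
    fix f assume f: "f \<in> ell2 ?S"
    note tf = tuple_vec_ell2[OF qs f]
    have "(\<lambda>s. (cmod (A (tuple_vec X qs f) (map s qs)))\<^sup>2) summable_on ?S"
      using summable_on_reindex_bij_betw[OF bij, of "\<lambda>s. (cmod (A (tuple_vec X qs f) s))\<^sup>2"]
        ell2_summable[OF bounded_op_ell2[OF A tf(1)]] by simp
    then show "on_register X qs A f \<in> ell2 ?S"
      by (auto simp: on_register_eq ell2_def cong: summable_on_cong)
    have "sqnorm ?S (on_register X qs A f) = sqnorm ?L (A (tuple_vec X qs f))"
      using infsum_reindex_bij_betw[OF bij, of "\<lambda>s. (cmod (A (tuple_vec X qs f) s))\<^sup>2"]
      by (simp add: sqnorm_def on_register_eq cong: infsum_cong)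
    then show "sqnorm ?S (on_register X qs A f) \<le> K * sqnorm ?S f"
      using K[OF tf(1)] tf(2) by simp
  next
    fix f g :: "('a \<Rightarrow> 'b) vec" and a b
    assume fg: "f \<in> ell2 ?S" "g \<in> ell2 ?S"
    have "tuple_vec X qs (\<lambda>s. a * f s + b * g s)
        = (\<lambda>xs. a * tuple_vec X qs f xs + b * tuple_vec X qs g xs)"
      by (auto simp: tuple_vec_def)
    then show "on_register X qs A (\<lambda>s. a * f s + b * g s)
        = (\<lambda>s. a * on_register X qs A f s + b * on_register X qs A g s)"
      using bounded_op_lincomb[OF A tuple_vec_ell2(1)[OF qs fg(1)] tuple_vec_ell2(1)[OF qs fg(2)]]
      by (auto simp: on_register_eq)
  qed
qed

section \<open>Slices and partial tensor products\<close>

text \<open>Only the labels of \<open>s\<close> outside \<open>W\<close> matter, so \<open>s\<close>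
  can be a labelling of all variables or of the complement of \<open>W\<close> alone; both uses
  occur.\<close>

definition slice ::
  "('q \<Rightarrow> 'b set) \<Rightarrow> 'q set \<Rightarrow> ('q \<Rightarrow> 'b) \<Rightarrow> ('q \<Rightarrow> 'b) vec \<Rightarrow> ('q \<Rightarrow> 'b) vec" where
  "slice X W s f = (\<lambda>t. if t \<in> PiE W X then f (override_on s t W) else 0)"

lemma tensor_id_eq:
  "tensor_id X W Z A f = (\<lambda>s. if s \<in> PiE (W \<union> Z) X then A (slice X W s f) (restrict s W) else 0)"
  unfolding tensor_id_def slice_def ..

lemma tensor_id_sub_eq:
  "W \<subseteq> V \<Longrightarrow> tensor_id X W (V - W) A f =
     (\<lambda>s. if s \<in> PiE V X then A (slice X W s f) (restrict s W) else 0)"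
  by (simp add: tensor_id_eq Un_absorb1)

lemma slice_lincomb:
  "slice X W s (\<lambda>x. a * f x + b * g x) = (\<lambda>x. a * slice X W s f x + b * slice X W s g x)"
  by (auto simp: slice_def)

lemma override_on_in_PiE:
  "s \<in> PiE V X \<Longrightarrow> t \<in> PiE W X \<Longrightarrow> W \<subseteq> V \<Longrightarrow> override_on s t W \<in> PiE V X"
  by (auto simp: override_on_def PiE_iff extensional_def)

lemma restrict_in_PiE: "s \<in> PiE V X \<Longrightarrow> W \<subseteq> V \<Longrightarrow> restrict s W \<in> PiE W X"
  by (auto simp: PiE_iff)

lemma restrict_override_on: "t \<in> PiE W X \<Longrightarrow> restrict (override_on s t W) W = t"
  by (auto simp: fun_eq_iff restrict_def override_on_def PiE_iff extensional_def)

lemma override_on_override_on: "override_on (override_on s t W) u W = override_on s u W"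
  by (auto simp: override_on_def)

lemma slice_override_on: "slice X W (override_on s t W) f = slice X W s f"
  unfolding slice_def override_on_override_on ..

text \<open>Sums over labellings of \<open>W \<union> Z\<close> become double sums along this
  splitting.\<close>

lemma bij_betw_override_on:
  assumes "W \<inter> Z = {}"
  shows "bij_betw (\<lambda>(z, t). override_on z t W) (PiE Z X \<times> PiE W X) (PiE (W \<union> Z) X)"
proof (rule bij_betwI[where g = "\<lambda>s. (restrict s Z, restrict s W)"], goal_cases)
  case 1
  then show ?case
    using assms by (auto simp: override_on_def PiE_iff extensional_def)
next
  case 2
  then show ?case
    by (auto simp: PiE_iff)
next
  case (3 x)
  then show ?case
    using assms
    by (auto simp: restrict_def override_on_def PiE_iff extensional_def fun_eq_iff)
next
  case (4 y)
  then show ?case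
    by (auto simp: restrict_def override_on_def PiE_iff extensional_def fun_eq_iff)
qed

text \<open>Tonelli's theorem for the squared moduli on a product of label sets.\<close>

lemma ell2_slices_iff:
  assumes "W \<inter> Z = {}" and supp: "\<And>s. s \<notin> PiE (W \<union> Z) X \<Longrightarrow> f s = 0"
  shows "f \<in> ell2 (PiE (W \<union> Z) X) \<longleftrightarrow>
      (\<forall>z\<in>PiE Z X. slice X W z f \<in> ell2 (PiE W X)) \<and>
      (\<lambda>z. sqnorm (PiE W X) (slice X W z f)) summable_on PiE Z X"
proof -
  let ?h = "\<lambda>s. (cmod (f s))\<^sup>2"
  have "f \<in> ell2 (PiE (W \<union> Z) X) \<longleftrightarrow> ?h summable_on PiE (W \<union> Z) X"
    using supp by (auto simp: ell2_def)
  also have "\<dots> \<longleftrightarrow> (\<lambda>(z, t). ?h (override_on z t W)) summable_on (PiE Z X \<times> PiE W X)"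
    using summable_on_reindex_bij_betw[OF bij_betw_override_on[OF assms(1)], of ?h X]
    by (simp add: case_prod_unfold)
  \<comment> \<open>For real families summability and absolute summability agree; the criterion for
    iterated sums concerns the latter.\<close>
  also have "\<dots> \<longleftrightarrow> (\<lambda>p. norm (case p of (z, t) \<Rightarrow> ?h (override_on z t W))) summable_on (PiE Z X \<times> PiE W X)"
    by (rule summable_on_iff_abs_summable_on_real)
  also have "\<dots> \<longleftrightarrow> (\<forall>z\<in>PiE Z X. slice X W z f \<in> ell2 (PiE W X)) \<and>
      (\<lambda>z. sqnorm (PiE W X) (slice X W z f)) summable_on PiE Z X"
    unfolding Infinite_Sum.abs_summable_on_Sigma_iff
    by (simp add: ell2_def sqnorm_def slice_def infsum_nonneg cong: summable_on_cong infsum_cong)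
  finally show ?thesis .
qed

lemma slice_ell2:
  assumes "W \<subseteq> V" "f \<in> ell2 (PiE V X)" "s \<in> PiE V X"
  shows "slice X W s f \<in> ell2 (PiE W X)"
proof -
  have "V = W \<union> (V - W)"
    using assms(1) by auto
  then have "slice X W (restrict s (V - W)) f \<in> ell2 (PiE W X)"
    using ell2_slices_iff[of W "V - W" X f] assms ell2_support[OF assms(2)]
      restrict_in_PiE[OF assms(3)] by auto
  also have "slice X W (restrict s (V - W)) f = slice X W s f"
  proof -
    \<comment> \<open>Away from \<open>W\<close>, the labelling \<open>s\<close> and its restriction
      agree: on \<open>V - W\<close> by definition, and off \<open>V\<close> because both are
      \<open>undefined\<close>.\<close>
    have ov: "override_on (restrict s (V - W)) t W = override_on s t W" for t
      using assms(1,3) by (auto simp: fun_eq_iff override_on_def PiE_iff extensional_def)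
    show ?thesis
      unfolding slice_def ov ..
  qed
  finally show ?thesis .
qed

lemma sqnorm_slices:
  assumes "W \<inter> Z = {}" "f \<in> ell2 (PiE (W \<union> Z) X)"
  shows "sqnorm (PiE (W \<union> Z) X) f = (\<Sum>\<^sub>\<infinity>z\<in>PiE Z X. sqnorm (PiE W X) (slice X W z f))"
proof -
  let ?h = "\<lambda>s. (cmod (f s))\<^sup>2"
  note bij = bij_betw_override_on[OF assms(1), of X]
  have "(\<lambda>p. ?h (override_on (fst p) (snd p) W)) summable_on (PiE Z X \<times> PiE W X)"
    using summable_on_reindex_bij_betw[OF bij, of ?h] ell2_summable[OF assms(2)]
    by (simp add: case_prod_unfold)
  from infsum_Sigma_banach[OF this] show ?thesis
    using infsum_reindex_bij_betw[OF bij, of ?h]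
    by (simp add: sqnorm_def slice_def case_prod_beta cong: infsum_cong)
qed

lemma tensor_id_support: "s \<notin> PiE (W \<union> Z) X \<Longrightarrow> tensor_id X W Z A f s = 0"
  by (simp add: tensor_id_def)

text \<open>Points that differ from \<open>s\<close> only on \<open>W\<close> share one slice, so on
  them the extension reads off a single vector, the image of that slice. The second assumption
  matches the cut-off in \<open>slice\<close>.\<close>

lemma slice_tensor_id:
  assumes "\<And>t. t \<in> PiE W X \<Longrightarrow> override_on s t W \<in> PiE (W \<union> Z) X"
    and "\<And>t. t \<notin> PiE W X \<Longrightarrow> A (slice X W s f) t = 0"
  shows "slice X W s (tensor_id X W Z A f) = A (slice X W s f)"
proof
  fix t
  show "slice X W s (tensor_id X W Z A f) t = A (slice X W s f) t"
  proof (cases "t \<in> PiE W X")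
    case True
    then have "slice X W s (tensor_id X W Z A f) t = tensor_id X W Z A f (override_on s t W)"
      by (simp add: slice_def)
    also have "\<dots> = A (slice X W s f) t"
      using True assms(1)[OF True] by (simp add: tensor_id_eq slice_override_on restrict_override_on)
    finally show ?thesis .
  qed (use assms(2) in \<open>simp add: slice_def\<close>)
qed

text \<open>Extended operators act slice by slice, hence they also compose slice by slice.\<close>

lemma tensor_id_comp:
  assumes "\<And>s t. t \<notin> PiE W X \<Longrightarrow> B (slice X W s f) t = 0"
  shows "tensor_id X W Z A (tensor_id X W Z B f) = tensor_id X W Z (\<lambda>g. A (B g)) f"
proof
  fix s
  show "tensor_id X W Z A (tensor_id X W Z B f) s = tensor_id X W Z (\<lambda>g. A (B g)) f s"
  proof (cases "s \<in> PiE (W \<union> Z) X")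
    case True
    then have "slice X W s (tensor_id X W Z B f) = B (slice X W s f)"
      using assms by (intro slice_tensor_id override_on_in_PiE) auto
    then show ?thesis
      by (simp add: tensor_id_eq)
  qed (simp add: tensor_id_support)
qed

text \<open>The \<open>W\<close>-slice of the \<open>U\<close>-slice at \<open>s\<close> is the
  \<open>W\<close>-slice at \<open>s\<close> itself, so extending in two stages changes
  nothing.\<close>

lemma tensor_id_trans:
  assumes "W \<subseteq> U" "U \<subseteq> V"
  shows "tensor_id X U (V - U) (tensor_id X W (U - W) A) f = tensor_id X W (V - W) A f"
proof
  fix s
  have WV: "W \<subseteq> V"
    using assms by auto
  show "tensor_id X U (V - U) (tensor_id X W (U - W) A) f s = tensor_id X W (V - W) A f s"
  proof (cases "s \<in> PiE V X")
    case True
    note s = restrict_in_PiE[OF True assms(2)]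
    have "override_on (restrict s U) t W \<in> PiE U X" if "t \<in> PiE W X" for t
      using s that assms(1) by (rule override_on_in_PiE)
    moreover have "override_on s (override_on (restrict s U) t W) U = override_on s t W" for t
      using assms(1) by (auto simp: fun_eq_iff override_on_def)
    ultimately have "slice X W (restrict s U) (slice X U s f) = slice X W s f"
      by (intro ext) (simp add: slice_def)
    moreover have "restrict (restrict s U) W = restrict s W"
      using assms(1) by (auto simp: fun_eq_iff restrict_def)
    ultimately show ?thesis
      using True s assms WV by (simp add: tensor_id_sub_eq)
  qed (use assms WV in \<open>simp add: tensor_id_sub_eq\<close>)
qed

text \<open>The operators see only slices of \<open>f\<close>, which are square-summable. Identities
  known on \<open>ell2\<close> alone can thus be lifted to \<open>V\<close>.\<close>

lemma tensor_id_cong: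
  assumes "W \<subseteq> V" "f \<in> ell2 (PiE V X)" "\<And>g. g \<in> ell2 (PiE W X) \<Longrightarrow> A g = B g"
  shows "tensor_id X W (V - W) A f = tensor_id X W (V - W) B f"
  using assms slice_ell2[OF assms(1,2)]
  by (auto simp: tensor_id_sub_eq fun_eq_iff)

text \<open>A bound \<open>K\<close> valid on every slice survives summation over the labellings of
  \<open>V - W\<close>.\<close>

lemma bounded_op_tensor_id:
  assumes WV: "W \<subseteq> V" and A: "bounded_op (PiE W X) A"
  shows "bounded_op (PiE V X) (tensor_id X W (V - W) A)"
proof -
  let ?T = "tensor_id X W (V - W) A" and ?N = "sqnorm (PiE W X)"
  have V: "W \<union> (V - W) = V"
    using WV by auto
  have disj: "W \<inter> (V - W) = {}"
    by auto
  obtain K where K: "\<And>f. f \<in> ell2 (PiE W X) \<Longrightarrow> ?N (A f) \<le> K * ?N f"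
    using bounded_op_boundE[OF A] by blast
  have bd: "?T f \<in> ell2 (PiE V X) \<and> sqnorm (PiE V X) (?T f) \<le> K * sqnorm (PiE V X) f"
    if f: "f \<in> ell2 (PiE V X)" for f
  proof -
    have f': "slice X W z f \<in> ell2 (PiE W X)" if "z \<in> PiE (V - W) X" for z
      using that f ell2_slices_iff[OF disj, of X f] ell2_support[OF f] unfolding V by blast
    have sf: "(\<lambda>z. ?N (slice X W z f)) summable_on PiE (V - W) X"
      using f ell2_slices_iff[OF disj, of X f] ell2_support[OF f] unfolding V by blast
    have sl: "slice X W z (?T f) = A (slice X W z f)" if z: "z \<in> PiE (V - W) X" for z
    proof (rule slice_tensor_id)
      fix t assume "t \<in> PiE W X"
      then show "override_on z t W \<in> PiE (W \<union> (V - W)) X"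
        using z by (auto simp: override_on_def PiE_iff extensional_def)
    next
      fix t assume "t \<notin> PiE W X"
      then show "A (slice X W z f) t = 0"
        by (rule ell2_support[OF bounded_op_ell2[OF A f'[OF z]]])
    qed
    have le: "?N (slice X W z (?T f)) \<le> K * ?N (slice X W z f)" if "z \<in> PiE (V - W) X" for z
      using sl[OF that] K[OF f'[OF that]] by simp
    have sT: "(\<lambda>z. ?N (slice X W z (?T f))) summable_on PiE (V - W) X"
      by (rule summable_on_comparison_test[OF summable_on_cmult_right[OF sf, of K]])
        (use le in \<open>auto simp: sqnorm_nonneg\<close>)
    have T: "?T f \<in> ell2 (PiE V X)"
      using ell2_slices_iff[OF disj, of X "?T f", OF tensor_id_support] sT sl bounded_op_ell2[OF A f']
      unfolding V by simp
    have "sqnorm (PiE V X) (?T f) = (\<Sum>\<^sub>\<infinity>z\<in>PiE (V - W) X. ?N (slice X W z (?T f)))"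
      using sqnorm_slices[OF disj, of "?T f" X, unfolded V] T by simp
    also have "\<dots> \<le> (\<Sum>\<^sub>\<infinity>z\<in>PiE (V - W) X. K * ?N (slice X W z f))"
      using sT summable_on_cmult_right[OF sf] le by (rule infsum_mono)
    also have "\<dots> = K * sqnorm (PiE V X) f"
      using sqnorm_slices[OF disj, of f X, unfolded V] f by (simp add: infsum_cmult_right')
    finally show ?thesis
      using T by simp
  qed
  show ?thesis
  proof (rule bounded_opI)
    fix f g :: "('a \<Rightarrow> 'b) vec" and a b
    assume f: "f \<in> ell2 (PiE V X)" and g: "g \<in> ell2 (PiE V X)"
    show "?T (\<lambda>x. a * f x + b * g x) = (\<lambda>x. a * ?T f x + b * ?T g x)"
      unfolding tensor_id_eq slice_lincomb V
      using bounded_op_lincomb[OF A slice_ell2[OF WV f] slice_ell2[OF WV g]]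
      by (auto simp: fun_eq_iff)
  qed (use bd in auto)
qed

text \<open>Only \<open>Q\<close> is required to have finitely many labels, so that an operator on \<open>Q\<close> acts on slices by
  a matrix and no continuity argument is needed.\<close>

lemma tensor_id_commute:
  assumes sub: "W \<subseteq> V" "Q \<subseteq> V" and disj: "W \<inter> Q = {}" and fin: "finite (PiE Q X)"
    and A: "bounded_op (PiE W X) A" and M: "bounded_op (PiE Q X) M"
    and f: "f \<in> ell2 (PiE V X)"
  shows "tensor_id X W (V - W) A (tensor_id X Q (V - Q) M f)
      = tensor_id X Q (V - Q) M (tensor_id X W (V - W) A f)"
proof
  fix s
  let ?TA = "tensor_id X W (V - W) A" and ?TM = "tensor_id X Q (V - Q) M"
  have ket: "ket b \<in> ell2 (PiE Q X)" if "b \<in> PiE Q X" for b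
    using that by (auto simp: ell2_finite[OF fin] ket_def)
  \<comment> \<open>A slice over \<open>Q\<close> is a finite combination of kets, so
    \<open>M\<close> acts through its matrix entries
    \<open>M (ket b) (restrict s Q)\<close>.\<close>
  have matrix: "?TM h s = (\<Sum>b\<in>PiE Q X. M (ket b) (restrict s Q) * h (override_on s b Q))"
    if "s \<in> PiE V X" for h s
  proof -
    have "slice X Q s h = (\<lambda>t. \<Sum>b\<in>PiE Q X. h (override_on s b Q) * ket b t)"
    proof
      fix t
      have "(\<Sum>b\<in>PiE Q X. h (override_on s b Q) * ket b t)
          = (\<Sum>b\<in>PiE Q X. if t = b then h (override_on s b Q) else 0)"
        by (intro sum.cong) (auto simp: ket_def)
      then show "slice X Q s h t = (\<Sum>b\<in>PiE Q X. h (override_on s b Q) * ket b t)"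
        using fin by (simp add: slice_def)
    qed
    then have "M (slice X Q s h) = (\<lambda>t. \<Sum>b\<in>PiE Q X. h (override_on s b Q) * M (ket b) t)"
      by (simp add: bounded_op_sum[OF M fin ket])
    then show ?thesis
      using that sub(2) by (simp add: tensor_id_sub_eq mult.commute)
  qed
  show "?TA (?TM f) s = ?TM (?TA f) s"
  proof (cases "s \<in> PiE V X")
    case True
    let ?o = "\<lambda>b. override_on s b Q"
    have o: "?o b \<in> PiE V X" if "b \<in> PiE Q X" for b
      using override_on_in_PiE[OF True that sub(2)] .
    \<comment> \<open>The matrix entries depend only on the \<open>Q\<close>-labels, which a change
      on \<open>W\<close> leaves alone. A \<open>W\<close>-slice of \<open>?TM f\<close> is
      therefore a finite combination of \<open>W\<close>-slices of \<open>f\<close>, to which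
      linearity of \<open>A\<close> applies.\<close>
    have "slice X W s (?TM f)
        = (\<lambda>t. \<Sum>b\<in>PiE Q X. M (ket b) (restrict s Q) * slice X W (?o b) f t)"
    proof
      fix t
      show "slice X W s (?TM f) t = (\<Sum>b\<in>PiE Q X. M (ket b) (restrict s Q) * slice X W (?o b) f t)"
      proof (cases "t \<in> PiE W X")
        case t: True
        have "restrict (override_on s t W) Q = restrict s Q"
          using disj by (auto simp: fun_eq_iff restrict_def override_on_def)
        moreover have "override_on (override_on s t W) b Q = override_on (?o b) t W" for b
          using disj by (auto simp: fun_eq_iff override_on_def)
        ultimately show ?thesis
          using t matrix[OF override_on_in_PiE[OF True t sub(1)], of f] by (simp add: slice_def)
      qed (simp add: slice_def)
    qed
    then have "?TA (?TM f) s
        = (\<Sum>b\<in>PiE Q X. M (ket b) (restrict s Q) * A (slice X W (?o b) f) (restrict s W))"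
      using True bounded_op_sum[OF A fin slice_ell2[OF sub(1) f o]] sub(1)
      by (simp add: tensor_id_sub_eq)
    also have "\<dots> = (\<Sum>b\<in>PiE Q X. M (ket b) (restrict s Q) * ?TA f (?o b))"
    proof (rule sum.cong[OF refl])
      fix b assume "b \<in> PiE Q X"
      moreover have "restrict (?o b) W = restrict s W"
        using disj by (auto simp: fun_eq_iff restrict_def override_on_def)
      ultimately show "M (ket b) (restrict s Q) * A (slice X W (?o b) f) (restrict s W)
          = M (ket b) (restrict s Q) * ?TA f (?o b)"
        using o sub(1) by (simp add: tensor_id_sub_eq)
    qed
    also have "\<dots> = ?TM (?TA f) s"
      using matrix[OF True] by simp
    finally show ?thesis .
  qed (use sub in \<open>simp add: tensor_id_sub_eq\<close>)
qed

section \<open>Boundedness of the circuit semantics\<close>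

text \<open>Gates are bounded as unitaries and branch projections as rank-one operators; extension,
  composition and finite sums preserve boundedness.\<close>

lemma bounded_op_sem:
  assumes "unitary_constants \<U>" "well_formed X \<U> C"
  shows "bounded_op (PiE (qv C) X) (sem X C)"
  using assms(2)
proof (induction C)
  case Skip
  show ?case
    using bounded_op_id by simp
next
  case (Gate U qs)
  then have "unitary_on (listset (map X qs)) (uop U)"
    using assms(1) by (auto simp: unitary_constants_def)
  then show ?case
    using Gate by (simp add: bounded_op_on_register bounded_op_unitary)
next
  case (Seq C D)
  have "bounded_op (PiE (qv (Seq C D)) X)
      (\<lambda>f. tensor_id X (qv D) (qv (Seq C D) - qv D) (sem X D)
        (tensor_id X (qv C) (qv (Seq C D) - qv C) (sem X C) f))"
    by (rule bounded_op_comp[OF bounded_op_tensor_id bounded_op_tensor_id]) (use Seq in auto)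
  moreover have "qv (Seq C D) - qv D = qv C - qv D" "qv (Seq C D) - qv C = qv D - qv C"
    by auto
  ultimately show ?case
    by (simp add: comp_def)
next
  case (QIf qs bs)
  let ?V = "qv (QIf qs bs)"
  have "bounded_op (PiE ?V X) (\<lambda>f. tensor_id X (set qs) (?V - set qs)
       (on_register X qs (ketbra (listset (map X qs)) (fst p)))
       (tensor_id X (qv (snd p)) (?V - qv (snd p)) (sem X (snd p)) f))" if p: "p \<in> set bs" for p
  proof (rule bounded_op_comp[OF bounded_op_tensor_id[OF _ bounded_op_on_register[OF _ bounded_op_ketbra]]
        bounded_op_tensor_id])
    show "distinct qs" "fst p \<in> ell2 (listset (map X qs))"
      using QIf.prems p by (auto simp: orthonormal_basis_def)
    \<comment> \<open>The induction hypothesis of the nested datatype reaches the branch circuits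
      through \<open>snds\<close>.\<close>
    show "bounded_op (PiE (qv (snd p)) X) (sem X (snd p))"
      using QIf p by (auto simp: snds.simps)
  qed (use p in auto)
  from bounded_op_sum_list[OF this] show ?case
    by (simp add: case_prod_unfold)
qed

section \<open>Circuits and projections on a common variable set\<close>

text \<open>Intended for \<open>V\<close> containing the variables of \<open>C\<close>: circuits on
  different variables then act on one space, where they can be composed and compared.\<close>

definition sem_on ::
  "('q \<Rightarrow> 'b set) \<Rightarrow> 'q set \<Rightarrow> ('q, 'b) circuit \<Rightarrow> ('q \<Rightarrow> 'b) lop" where
  "sem_on X V C = tensor_id X (qv C) (V - qv C) (sem X C)"

definition register_proj ::
  "('q \<Rightarrow> 'b set) \<Rightarrow> 'q set \<Rightarrow> 'q list \<Rightarrow> 'b list vec \<Rightarrow> ('q \<Rightarrow> 'b) lop" where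
  "register_proj X V qs \<psi> =
     tensor_id X (set qs) (V - set qs) (on_register X qs (ketbra (listset (map X qs)) \<psi>))"

text \<open>A composite formed on \<open>U\<close> and then extended equals the composite of the
  direct extensions, by compatibility of extension with composition and by its transitivity.\<close>

lemma tensor_id_comp_sub:
  assumes "W \<subseteq> U" "Z \<subseteq> U" "U \<subseteq> V"
  shows "tensor_id X U (V - U)
      (\<lambda>g. tensor_id X W (U - W) A (tensor_id X Z (U - Z) B g)) f
    = tensor_id X W (V - W) A (tensor_id X Z (V - Z) B f)"
proof -
  let ?A = "tensor_id X W (U - W) A" and ?B = "tensor_id X Z (U - Z) B"
  have "tensor_id X U (V - U) ?A (tensor_id X U (V - U) ?B f) =
      tensor_id X U (V - U) (\<lambda>g. ?A (?B g)) f"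
    by (rule tensor_id_comp[where A = ?A and B = ?B]) (use assms(2) in \<open>simp add: tensor_id_sub_eq\<close>)
  then show ?thesis
    unfolding tensor_id_trans[OF assms(1,3)] tensor_id_trans[OF assms(2,3)] by (rule sym)
qed

lemma sem_on_Seq:
  assumes "qv C \<union> qv D \<subseteq> V"
  shows "sem_on X V (Seq C D) f = sem_on X V D (sem_on X V C f)"
proof -
  let ?U = "qv C \<union> qv D"
  \<comment> \<open>The semantics writes complements as differences of the two variable sets; these
    are the complements within the union.\<close>
  have "qv C - qv D = ?U - qv D" "qv D - qv C = ?U - qv C"
    by auto
  then have "sem X (Seq C D) =
      (\<lambda>g. tensor_id X (qv D) (?U - qv D) (sem X D) (tensor_id X (qv C) (?U - qv C) (sem X C) g))"
    by (simp add: comp_def)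
  then show ?thesis
    unfolding sem_on_def using tensor_id_comp_sub[of "qv D" ?U "qv C" V] assms by simp
qed

text \<open>Extension is evaluated pointwise, so the sum over branches passes through it; each
  summand is a composite to be extended from the variables of the conditional to
  \<open>V\<close>.\<close>

lemma sem_on_QIf:
  assumes "qv (QIf qs bs) \<subseteq> V"
  shows "sem_on X V (QIf qs bs) f =
    (\<lambda>s. \<Sum>(\<psi>, C)\<leftarrow>bs. register_proj X V qs \<psi> (sem_on X V C f) s)"
proof
  fix s
  let ?U = "qv (QIf qs bs)"
  let ?T = "\<lambda>p g. tensor_id X (set qs) (?U - set qs)
      (on_register X qs (ketbra (listset (map X qs)) (fst p)))
      (tensor_id X (qv (snd p)) (?U - qv (snd p)) (sem X (snd p)) g)"
  have sem: "sem X (QIf qs bs) = (\<lambda>g t. \<Sum>p\<leftarrow>bs. ?T p g t)"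
    by (simp add: case_prod_unfold)
  have "sem_on X V (QIf qs bs) f s = (\<Sum>p\<leftarrow>bs. tensor_id X ?U (V - ?U) (?T p) f s)"
    unfolding sem_on_def sem using assms by (simp only: tensor_id_sub_eq) simp
  also have "\<dots> = (\<Sum>p\<leftarrow>bs. register_proj X V qs (fst p) (sem_on X V (snd p) f) s)"
  proof (intro arg_cong[where f = sum_list] map_cong refl)
    fix p assume "p \<in> set bs"
    then have "set qs \<subseteq> ?U" "qv (snd p) \<subseteq> ?U"
      by auto
    from fun_cong[OF tensor_id_comp_sub[OF this assms]]
    show "tensor_id X ?U (V - ?U) (?T p) f s = register_proj X V qs (fst p) (sem_on X V (snd p) f) s"
      unfolding register_proj_def sem_on_def .
  qed
  finally show "sem_on X V (QIf qs bs) f s =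
      (\<Sum>(\<psi>, C)\<leftarrow>bs. register_proj X V qs \<psi> (sem_on X V C f) s)"
    by (simp add: case_prod_unfold)
qed

text \<open>The form \<open>P\<^sub>0 C\<^sub>0 + P\<^sub>1 C\<^sub>1\<close> behind all later
  computations: in each branch the circuit acts first and the projection second.\<close>

lemma sem_on_choice:
  assumes "qv (choice q \<phi>0 \<phi>1 C0 C1) \<subseteq> V"
  shows "sem_on X V (choice q \<phi>0 \<phi>1 C0 C1) f =
    (\<lambda>s. register_proj X V [q] \<phi>0 (sem_on X V C0 f) s + register_proj X V [q] \<phi>1 (sem_on X V C1 f) s)"
  using assms unfolding choice_def by (subst sem_on_QIf) auto

lemma bounded_op_sem_on:
  assumes "unitary_constants \<U>" "well_formed X \<U> C" "qv C \<subseteq> V"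
  shows "bounded_op (PiE V X) (sem_on X V C)"
  unfolding sem_on_def using assms by (intro bounded_op_tensor_id bounded_op_sem)

lemma bounded_op_register_proj:
  assumes "distinct qs" "set qs \<subseteq> V" "\<psi> \<in> ell2 (listset (map X qs))"
  shows "bounded_op (PiE V X) (register_proj X V qs \<psi>)"
  unfolding register_proj_def using assms
  by (intro bounded_op_tensor_id bounded_op_on_register bounded_op_ketbra)

lemma sem_on_register_proj_commute:
  assumes "unitary_constants \<U>" "well_formed X \<U> C" "qv C \<subseteq> V"
    and "distinct qs" "set qs \<subseteq> V" "\<psi> \<in> ell2 (listset (map X qs))" "finite (PiE (set qs) X)"
    and "qv C \<inter> set qs = {}" "f \<in> ell2 (PiE V X)"
  shows "sem_on X V C (register_proj X V qs \<psi> f) = register_proj X V qs \<psi> (sem_on X V C f)"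
  unfolding sem_on_def register_proj_def using assms
  by (intro tensor_id_commute bounded_op_sem bounded_op_on_register bounded_op_ketbra)

lemma sem_on_commute:
  assumes "unitary_constants \<U>" "well_formed X \<U> C" "qv C \<subseteq> V"
    and "well_formed X \<U> D" "qv D \<subseteq> V" "finite (PiE (qv D) X)"
    and "qv C \<inter> qv D = {}" "f \<in> ell2 (PiE V X)"
  shows "sem_on X V C (sem_on X V D f) = sem_on X V D (sem_on X V C f)"
  unfolding sem_on_def using assms
  by (intro tensor_id_commute bounded_op_sem)

section \<open>Algebra of rank-one projections on a register\<close>

lemma on_register_comp:
  assumes "distinct qs" "\<And>xs. xs \<notin> listset (map X qs) \<Longrightarrow> K (tuple_vec X qs f) xs = 0"
  shows "on_register X qs A (on_register X qs K f) = on_register X qs (\<lambda>g. A (K g)) f"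
  using tuple_vec_on_register[of qs X K f, OF assms]
  by (intro ext) (simp add: on_register_eq[of X qs A] on_register_eq[of X qs "\<lambda>g. A (K g)"])

lemma ketbra_support: "\<psi> \<in> ell2 S \<Longrightarrow> x \<notin> S \<Longrightarrow> ketbra S \<psi> g x = 0"
  by (simp add: ketbra_def ell2_support)

text \<open>Scalar factors leave infinite sums whether or not these converge, so the product rule
  holds for every \<open>g\<close>.\<close>

lemma ketbra_ketbra:
  "ketbra S \<psi> (ketbra S \<theta> g) = (\<lambda>x. l2_inner S \<psi> \<theta> * \<psi> x * l2_inner S \<theta> g)"
  by (simp add: ketbra_def l2_inner_scale fun_eq_iff)

text \<open>Reduces products of projections on \<open>V\<close> to products of rank-one operators on
  tuples, since both transport and extension respect composition.\<close>

lemma register_proj_comp: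
  assumes "distinct qs" "set qs \<subseteq> V" "\<theta> \<in> ell2 (listset (map X qs))"
  shows "register_proj X V qs \<psi> (register_proj X V qs \<theta> f) =
    tensor_id X (set qs) (V - set qs)
      (on_register X qs (\<lambda>g. ketbra (listset (map X qs)) \<psi> (ketbra (listset (map X qs)) \<theta> g))) f"
proof -
  let ?S = "listset (map X qs)"
  have "register_proj X V qs \<psi> (register_proj X V qs \<theta> f) =
      tensor_id X (set qs) (V - set qs)
        (\<lambda>g. on_register X qs (ketbra ?S \<psi>) (on_register X qs (ketbra ?S \<theta>) g)) f"
    unfolding register_proj_def by (rule tensor_id_comp) (simp add: on_register_eq)
  then show ?thesis
    using assms by (simp add: on_register_comp ketbra_support)
qed

lemma register_proj_idem:
  assumes "distinct qs" "set qs \<subseteq> V" "\<psi> \<in> ell2 (listset (map X qs))"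
    and "l2_inner (listset (map X qs)) \<psi> \<psi> = 1"
  shows "register_proj X V qs \<psi> (register_proj X V qs \<psi> f) = register_proj X V qs \<psi> f"
proof -
  have "(\<lambda>g. ketbra (listset (map X qs)) \<psi> (ketbra (listset (map X qs)) \<psi> g))
      = ketbra (listset (map X qs)) \<psi>"
    unfolding ketbra_ketbra assms(4) by (simp add: ketbra_def fun_eq_iff)
  then show ?thesis
    unfolding register_proj_comp[OF assms(1-3)] by (simp only: register_proj_def)
qed

lemma register_proj_orth:
  assumes "distinct qs" "set qs \<subseteq> V" "\<theta> \<in> ell2 (listset (map X qs))"
    and "l2_inner (listset (map X qs)) \<psi> \<theta> = 0"
  shows "register_proj X V qs \<psi> (register_proj X V qs \<theta> f) = (\<lambda>s. 0)"
  unfolding register_proj_comp[OF assms(1-3)] ketbra_ketbra assms(4)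
  by (simp add: tensor_id_def on_register_def fun_eq_iff)

text \<open>Orthonormality removes every term except the \<open>i\<close>-th.\<close>

lemma ketbra_expansion:
  assumes "orthonormal_basis S bs" "i < length bs"
  shows "ketbra S (bs ! i) (\<lambda>x. \<Sum>j<length bs. c j * (bs ! j) x) = (\<lambda>x. c i * (bs ! i) x)"
proof -
  have b: "bs ! j \<in> ell2 S" if "j < length bs" for j
    using assms(1) that by (auto simp: orthonormal_basis_def)
  have "ketbra S (bs ! i) (\<lambda>x. \<Sum>j<length bs. c j * (bs ! j) x)
      = (\<lambda>x. \<Sum>j<length bs. c j * ketbra S (bs ! i) (bs ! j) x)"
    by (rule bounded_op_sum[OF bounded_op_ketbra[OF b[OF assms(2)]]]) (use b in auto)
  also have "\<dots> = (\<lambda>x. \<Sum>j<length bs. if i = j then c i * (bs ! i) x else 0)"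
    using assms by (intro ext sum.cong) (auto simp: ketbra_def orthonormal_basis_def)
  finally show ?thesis
    using assms(2) by simp
qed

text \<open>For \<open>g\<close> with coordinates \<open>c j\<close> in \<open>bs\<close>, the
  vector \<open>A g\<close> has coordinates \<open>c j * l j\<close> in \<open>ds\<close>, so both
  sides are \<open>c i * l i\<close> times the \<open>i\<close>-th vector of
  \<open>ds\<close>.\<close>

lemma ketbra_intertwine:
  assumes A: "bounded_op S A"
    and bs: "orthonormal_basis S bs" and ds: "orthonormal_basis S ds" and len: "length ds = length bs"
    and eig: "\<And>j. j < length bs \<Longrightarrow> A (bs ! j) = (\<lambda>x. l j * (ds ! j) x)"
    and i: "i < length bs" and g: "g \<in> ell2 S"
  shows "A (ketbra S (bs ! i) g) = ketbra S (ds ! i) (A g)"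
proof -
  have b: "bs ! j \<in> ell2 S" if "j < length bs" for j
    using bs that by (auto simp: orthonormal_basis_def)
  obtain c where c: "g = (\<lambda>x. \<Sum>j<length bs. c j * (bs ! j) x)"
    using bs g by (auto simp: orthonormal_basis_def)
  have "A g = (\<lambda>x. \<Sum>j<length bs. c j * A (bs ! j) x)"
    unfolding c by (rule bounded_op_sum[OF A]) (use b in auto)
  also have "\<dots> = (\<lambda>x. \<Sum>j<length ds. (c j * l j) * (ds ! j) x)"
    using eig by (simp add: len mult.assoc)
  finally have "ketbra S (ds ! i) (A g) = (\<lambda>x. (c i * l i) * (ds ! i) x)"
    using ketbra_expansion[OF ds, of i "\<lambda>j. c j * l j"] i len by simp
  moreover have "A (ketbra S (bs ! i) g) = (\<lambda>x. c i * A (bs ! i) x)"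
    unfolding c ketbra_expansion[OF bs i] by (rule bounded_op_scale[OF A b[OF i]])
  ultimately show ?thesis
    using eig[OF i] by (simp add: mult.assoc)
qed

text \<open>Gate and projection live on the same register: they are merged into one operator there,
  exchanged by \<open>inter\<close>, and separated again.\<close>

lemma sem_on_Gate_register_proj:
  assumes "unitary_constants \<U>" "well_formed X \<U> (Gate U qs)" "set qs \<subseteq> V"
    and \<phi>: "\<phi> \<in> ell2 (listset (map X qs))"
    and inter: "\<And>g. g \<in> ell2 (listset (map X qs)) \<Longrightarrow>
      uop U (ketbra (listset (map X qs)) \<phi> g) = ketbra (listset (map X qs)) \<psi> (uop U g)"
    and f: "f \<in> ell2 (PiE V X)"
  shows "sem_on X V (Gate U qs) (register_proj X V qs \<phi> f)
      = register_proj X V qs \<psi> (sem_on X V (Gate U qs) f)"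
proof -
  let ?S = "listset (map X qs)" and ?T = "tensor_id X (set qs) (V - set qs)"
  have qs: "distinct qs" and U: "bounded_op ?S (uop U)"
    using assms(1,2) by (auto simp: unitary_constants_def intro!: bounded_op_unitary)
  have "sem_on X V (Gate U qs) (register_proj X V qs \<phi> f)
      = ?T (\<lambda>g. on_register X qs (uop U) (on_register X qs (ketbra ?S \<phi>) g)) f"
    unfolding sem_on_def register_proj_def qv.simps sem.simps
    by (rule tensor_id_comp) (simp add: on_register_eq)
  \<comment> \<open>Since \<open>inter\<close> is available only on \<open>ell2\<close>, the
    exchange is made under the congruence rule for square-summable slices.\<close>
  also have "\<dots> = ?T (\<lambda>g. on_register X qs (ketbra ?S \<psi>) (on_register X qs (uop U) g)) f"
  proof (rule tensor_id_cong[OF assms(3) f])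
    fix g assume "g \<in> ell2 (PiE (set qs) X)"
    then have g: "tuple_vec X qs g \<in> ell2 ?S"
      by (rule tuple_vec_ell2[OF qs])
    have "on_register X qs (uop U) (on_register X qs (ketbra ?S \<phi>) g)
        = on_register X qs (\<lambda>g. uop U (ketbra ?S \<phi> g)) g"
      using qs ketbra_support[OF \<phi>] by (rule on_register_comp)
    also have "\<dots> = on_register X qs (\<lambda>g. ketbra ?S \<psi> (uop U g)) g"
      unfolding on_register_eq inter[OF g] ..
    also have "\<dots> = on_register X qs (ketbra ?S \<psi>) (on_register X qs (uop U) g)"
      using qs ell2_support[OF bounded_op_ell2[OF U g]] by (rule on_register_comp[symmetric])
    finally show "on_register X qs (uop U) (on_register X qs (ketbra ?S \<phi>) g)
        = on_register X qs (ketbra ?S \<psi>) (on_register X qs (uop U) g)" .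
  qed
  also have "\<dots> = register_proj X V qs \<psi> (sem_on X V (Gate U qs) f)"
    unfolding sem_on_def register_proj_def qv.simps sem.simps
    by (rule tensor_id_comp[symmetric]) (simp add: on_register_eq)
  finally show ?thesis .
qed

section \<open>Laws of the choice construct\<close>

text \<open>Fits all the claimed equivalences, whose two sides have the same variables.\<close>

lemma circuit_equivI:
  assumes "qv C = V" "qv D = V"
    and "\<And>f. f \<in> ell2 (PiE V X) \<Longrightarrow> sem_on X V C f = sem_on X V D f"
  shows "circuit_equiv X C D"
  using assms by (simp add: circuit_equiv_def sem_on_def)

lemma orthonormal_basis_pairD:
  assumes "orthonormal_basis S [\<phi>0, \<phi>1]"
  shows "\<phi>0 \<in> ell2 S" "\<phi>1 \<in> ell2 S"
    "l2_inner S \<phi>0 \<phi>0 = 1" "l2_inner S \<phi>1 \<phi>1 = 1" "l2_inner S \<phi>0 \<phi>1 = 0" "l2_inner S \<phi>1 \<phi>0 = 0"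
proof -
  have "l2_inner S ([\<phi>0, \<phi>1] ! i) ([\<phi>0, \<phi>1] ! j) = (if i = j then 1 else 0)" if "i < 2" "j < 2" for i j
    using assms that by (simp add: orthonormal_basis_def)
  from this[of 0 0] this[of 1 1] this[of 0 1] this[of 1 0]
  show "l2_inner S \<phi>0 \<phi>0 = 1" "l2_inner S \<phi>1 \<phi>1 = 1" "l2_inner S \<phi>0 \<phi>1 = 0" "l2_inner S \<phi>1 \<phi>0 = 0"
    by simp_all
qed (use assms in \<open>auto simp: orthonormal_basis_def\<close>)

lemma finite_qubit: "qubit X q \<Longrightarrow> finite (PiE {q} X)"
  by (intro finite_PiE) (auto simp: qubit_def)

lemma qv_choice: "qv (choice q \<phi>0 \<phi>1 C0 C1) = {q} \<union> qv C0 \<union> qv C1"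
  by (auto simp: choice_def)

lemma sem_on_choice_swap:
  assumes "qv (choice q \<phi>0 \<phi>1 C0 C1) \<subseteq> V"
  shows "sem_on X V (choice q \<phi>0 \<phi>1 C0 C1) f = sem_on X V (choice q \<phi>1 \<phi>0 C1 C0) f"
  using assms by (simp add: sem_on_choice qv_choice add.commute)

text \<open>A common first step of the branches precedes both projections, so it factors out by
  unfolding alone.\<close>

lemma choice_Seq_left:
  assumes "qv (choice q \<phi>0 \<phi>1 C0 C1) \<subseteq> V" "qv C \<subseteq> V"
  shows "sem_on X V (choice q \<phi>0 \<phi>1 (Seq C C0) (Seq C C1)) f
      = sem_on X V (choice q \<phi>0 \<phi>1 C0 C1) (sem_on X V C f)"
  using assms by (simp add: sem_on_choice qv_choice sem_on_Seq)

text \<open>To enter the branches as their last step, \<open>C\<close> must pass the projections; it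
  commutes with them because it does not touch \<open>q\<close>.\<close>

lemma choice_Seq_right:
  assumes \<U>: "unitary_constants \<U>" and q: "qubit X q"
    and onb: "orthonormal_basis (listset [X q]) [\<phi>0, \<phi>1]"
    and wf: "well_formed X \<U> C0" "well_formed X \<U> C1" "well_formed X \<U> C"
    and V: "{q} \<union> qv C0 \<union> qv C1 \<union> qv C \<subseteq> V" and "q \<notin> qv C"
    and f: "f \<in> ell2 (PiE V X)"
  shows "sem_on X V C (sem_on X V (choice q \<phi>0 \<phi>1 C0 C1) f)
      = sem_on X V (choice q \<phi>0 \<phi>1 (Seq C0 C) (Seq C1 C)) f"
proof -
  let ?P0 = "register_proj X V [q] \<phi>0" and ?P1 = "register_proj X V [q] \<phi>1"
  let ?S = "\<lambda>D. sem_on X V D"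
  note basis = orthonormal_basis_pairD[OF onb]
  have P: "bounded_op (PiE V X) ?P0" "bounded_op (PiE V X) ?P1"
    using V basis by (auto intro!: bounded_op_register_proj)
  have bC: "bounded_op (PiE V X) (?S C)"
    using V by (intro bounded_op_sem_on[OF \<U> wf(3)]) auto
  have S: "?S C0 f \<in> ell2 (PiE V X)" "?S C1 f \<in> ell2 (PiE V X)"
    using V f by (auto intro!: bounded_op_ell2[OF bounded_op_sem_on[OF \<U>]] wf)
  have comm: "?S C (register_proj X V [q] \<phi> g) = register_proj X V [q] \<phi> (?S C g)"
    if "\<phi> \<in> ell2 (listset [X q])" "g \<in> ell2 (PiE V X)" for \<phi> g
    using V that \<open>q \<notin> qv C\<close> finite_qubit[OF q]
    by (intro sem_on_register_proj_commute[OF \<U> wf(3)]) auto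
  have "?S C (?S (choice q \<phi>0 \<phi>1 C0 C1) f) = ?S C (\<lambda>s. ?P0 (?S C0 f) s + ?P1 (?S C1 f) s)"
    using V by (simp add: sem_on_choice qv_choice)
  also have "\<dots> = (\<lambda>s. ?S C (?P0 (?S C0 f)) s + ?S C (?P1 (?S C1 f)) s)"
    by (rule bounded_op_add[OF bC bounded_op_ell2[OF P(1) S(1)] bounded_op_ell2[OF P(2) S(2)]])
  also have "\<dots> = (\<lambda>s. ?P0 (?S C (?S C0 f)) s + ?P1 (?S C (?S C1 f)) s)"
    using comm[OF basis(1) S(1)] comm[OF basis(2) S(2)] by simp
  also have "\<dots> = ?S (choice q \<phi>0 \<phi>1 (Seq C0 C) (Seq C1 C)) f"
    using V by (simp add: sem_on_choice qv_choice sem_on_Seq)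
  finally show ?thesis .
qed

text \<open>Moving each of \<open>D0\<close>, \<open>D1\<close> past the projections of the first
  choice leaves products of projections, of which only the diagonal ones survive.\<close>

lemma choice_Seq_choice:
  assumes \<U>: "unitary_constants \<U>" and q: "qubit X q"
    and onb: "orthonormal_basis (listset [X q]) [\<phi>0, \<phi>1]"
    and wf: "well_formed X \<U> C0" "well_formed X \<U> C1" "well_formed X \<U> D0" "well_formed X \<U> D1"
    and V: "{q} \<union> qv C0 \<union> qv C1 \<union> qv D0 \<union> qv D1 \<subseteq> V" and nq: "q \<notin> qv D0" "q \<notin> qv D1"
    and f: "f \<in> ell2 (PiE V X)"
  shows "sem_on X V (choice q \<phi>0 \<phi>1 D0 D1) (sem_on X V (choice q \<phi>0 \<phi>1 C0 C1) f)
      = sem_on X V (choice q \<phi>0 \<phi>1 (Seq C0 D0) (Seq C1 D1)) f"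
proof -
  let ?P0 = "register_proj X V [q] \<phi>0" and ?P1 = "register_proj X V [q] \<phi>1"
  let ?S = "\<lambda>D. sem_on X V D" and ?H = "ell2 (PiE V X)"
  note basis = orthonormal_basis_pairD[OF onb]
  have P: "bounded_op (PiE V X) ?P0" "bounded_op (PiE V X) ?P1"
    using V basis by (auto intro!: bounded_op_register_proj)
  have S: "?S D g \<in> ?H" if "well_formed X \<U> D" "qv D \<subseteq> V" "g \<in> ?H" for D g
    using that by (intro bounded_op_ell2[OF bounded_op_sem_on[OF \<U>]])
  have PP: "?P0 (?P0 g) = ?P0 g" "?P1 (?P1 g) = ?P1 g" "?P0 (?P1 g) = (\<lambda>s. 0)" "?P1 (?P0 g) = (\<lambda>s. 0)"
    for g
    using V basis by (auto intro!: register_proj_idem register_proj_orth)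
  \<comment> \<open>One circuit \<open>D\<close> is pushed into both branches; it is later taken to
    be \<open>D0\<close> and \<open>D1\<close> in turn.\<close>
  have right: "?S D (?S (choice q \<phi>0 \<phi>1 C0 C1) f) = (\<lambda>s. ?P0 (?S D (?S C0 f)) s + ?P1 (?S D (?S C1 f)) s)"
    if "well_formed X \<U> D" "qv D \<subseteq> V" "q \<notin> qv D" for D
    using choice_Seq_right[OF \<U> q onb wf(1,2) that(1) _ that(3) f] V that(2)
    by (simp add: sem_on_choice qv_choice sem_on_Seq)
  have H: "?S D (?S E f) \<in> ?H"
    if "well_formed X \<U> D" "qv D \<subseteq> V" "well_formed X \<U> E" "qv E \<subseteq> V" for D E
    using that f by (intro S)
  \<comment> \<open>Each projection of the second choice selects its own branch of the first and
    annihilates the other.\<close>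
  have split: "?P0 (\<lambda>s. ?P0 g s + ?P1 h s) = ?P0 g" "?P1 (\<lambda>s. ?P0 g s + ?P1 h s) = ?P1 h"
    if "g \<in> ?H" "h \<in> ?H" for g h
    using bounded_op_add[OF P(1) bounded_op_ell2[OF P(1) that(1)] bounded_op_ell2[OF P(2) that(2)]]
      bounded_op_add[OF P(2) bounded_op_ell2[OF P(1) that(1)] bounded_op_ell2[OF P(2) that(2)]]
    by (simp_all add: PP)
  have "?S (choice q \<phi>0 \<phi>1 D0 D1) (?S (choice q \<phi>0 \<phi>1 C0 C1) f)
      = (\<lambda>s. ?P0 (?S D0 (?S (choice q \<phi>0 \<phi>1 C0 C1) f)) s + ?P1 (?S D1 (?S (choice q \<phi>0 \<phi>1 C0 C1) f)) s)"
    by (rule sem_on_choice) (use V in \<open>simp add: qv_choice\<close>)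
  also have "\<dots> = (\<lambda>s. ?P0 (?S D0 (?S C0 f)) s + ?P1 (?S D1 (?S C1 f)) s)"
    using V by (simp add: right wf nq split H)
  also have "\<dots> = ?S (choice q \<phi>0 \<phi>1 (Seq C0 D0) (Seq C1 D1)) f"
    using V by (simp add: sem_on_choice qv_choice sem_on_Seq)
  finally show ?thesis .
qed

text \<open>The gate turns each \<open>\<phi>\<close> projection into the matching
  \<open>\<psi>\<close> projection when it moves past it, and it commutes with the branch circuits
  because these do not contain \<open>q\<close>.\<close>

lemma choice_symmetry:
  assumes \<U>: "unitary_constants \<U>" and q: "qubit X q"
    and onb: "orthonormal_basis (listset [X q]) [\<phi>0, \<phi>1]" "orthonormal_basis (listset [X q]) [\<psi>0, \<psi>1]"
    and U: "U \<in> \<U>" "utype U = [X q]"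
    and eig: "uop U \<phi>0 = (\<lambda>x. l0 * \<psi>0 x)" "uop U \<phi>1 = (\<lambda>x. l1 * \<psi>1 x)"
    and wf: "well_formed X \<U> C0" "well_formed X \<U> C1"
    and V: "{q} \<union> qv C0 \<union> qv C1 \<subseteq> V" and nq: "q \<notin> qv C0" "q \<notin> qv C1"
    and f: "f \<in> ell2 (PiE V X)"
  shows "sem_on X V (choice q \<psi>0 \<psi>1 C0 C1) (sem_on X V (Gate U [q]) f)
      = sem_on X V (Gate U [q]) (sem_on X V (choice q \<phi>0 \<phi>1 C0 C1) f)"
proof -
  let ?G = "Gate U [q]"
  let ?S = "\<lambda>D. sem_on X V D" and ?P = "register_proj X V [q]" and ?L = "listset [X q]"
  note basis = orthonormal_basis_pairD[OF onb(1)]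
  have wfG: "well_formed X \<U> ?G"
    using U by simp
  have bU: "bounded_op ?L (uop U)"
    using \<U> U by (auto simp: unitary_constants_def intro!: bounded_op_unitary)
  have bG: "bounded_op (PiE V X) (?S ?G)"
    using V by (intro bounded_op_sem_on[OF \<U> wfG]) auto
  have P: "bounded_op (PiE V X) (?P \<phi>0)" "bounded_op (PiE V X) (?P \<phi>1)"
    using V basis by (auto intro!: bounded_op_register_proj)
  have S: "?S C0 f \<in> ell2 (PiE V X)" "?S C1 f \<in> ell2 (PiE V X)"
    using V f by (auto intro!: bounded_op_ell2[OF bounded_op_sem_on[OF \<U>]] wf)
  \<comment> \<open>The two eigenvector-like relations are indexed by lists to fit the intertwining
    lemma.\<close>
  have eig': "uop U ([\<phi>0, \<phi>1] ! j) = (\<lambda>x. ([l0, l1] ! j) * ([\<psi>0, \<psi>1] ! j) x)" if "j < 2" for j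
    using eig that by (auto simp: less_2_cases_iff)
  have inter: "uop U (ketbra ?L ([\<phi>0, \<phi>1] ! i) g) = ketbra ?L ([\<psi>0, \<psi>1] ! i) (uop U g)"
    if "i < 2" "g \<in> ell2 ?L" for i g
    using ketbra_intertwine[OF bU onb, of "\<lambda>j. [l0, l1] ! j" i g] eig' that by simp
  have move: "?S ?G (?P \<phi>0 g) = ?P \<psi>0 (?S ?G g)" "?S ?G (?P \<phi>1 g) = ?P \<psi>1 (?S ?G g)"
    if "g \<in> ell2 (PiE V X)" for g
    using V basis inter[of 0] inter[of 1] that
    by (auto intro!: sem_on_Gate_register_proj[OF \<U> wfG])
  have comm: "?S C (?S ?G f) = ?S ?G (?S C f)"
    if "well_formed X \<U> C" "qv C \<subseteq> V" "q \<notin> qv C" for C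
    using that V f finite_qubit[OF q] by (intro sem_on_commute[OF \<U> that(1,2) wfG]) auto
  have "?S ?G (?S (choice q \<phi>0 \<phi>1 C0 C1) f) = ?S ?G (\<lambda>s. ?P \<phi>0 (?S C0 f) s + ?P \<phi>1 (?S C1 f) s)"
    using V by (simp add: sem_on_choice qv_choice)
  also have "\<dots> = (\<lambda>s. ?S ?G (?P \<phi>0 (?S C0 f)) s + ?S ?G (?P \<phi>1 (?S C1 f)) s)"
    by (rule bounded_op_add[OF bG bounded_op_ell2[OF P(1) S(1)] bounded_op_ell2[OF P(2) S(2)]])
  also have "\<dots> = (\<lambda>s. ?P \<psi>0 (?S C0 (?S ?G f)) s + ?P \<psi>1 (?S C1 (?S ?G f)) s)"
    using V by (simp add: move S comm wf nq)
  also have "\<dots> = ?S (choice q \<psi>0 \<psi>1 C0 C1) (?S ?G f)"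
    using V by (simp add: sem_on_choice qv_choice)
  finally show ?thesis ..
qed

lemma orthonormal_basis_kets:
  assumes "a \<noteq> b"
  shows "orthonormal_basis {a, b} [ket a, ket b]"
proof -
  \<comment> \<open>The coefficients are the values of \<open>f\<close> at \<open>a\<close> and
    \<open>b\<close>.\<close>
  have "\<exists>c. f = (\<lambda>x. \<Sum>i<Suc (Suc 0). c i * ([ket a, ket b] ! i) x)" if "f \<in> ell2 {a, b}" for f
    using assms ell2_support[OF that]
    by (intro exI[of _ "\<lambda>i. f ([a, b] ! i)"]) (auto simp: ket_def fun_eq_iff)
  then show ?thesis
    using assms
    by (auto simp: orthonormal_basis_def ell2_finite ket_def l2_inner_def less_Suc_eq)
qed

section \<open>Symmetry, sequentiality and distributivity of quantum choice\<close>

theorem proposition4p3: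
  fixes X :: "'q \<Rightarrow> 'b::zero_neq_one set" and \<U> :: "'b uconst set"
    and q :: 'q and B C C0 C1 D0 D1 :: "('q, 'b) circuit"
    and \<phi>0 \<phi>1 :: "'b list \<Rightarrow> complex"
  assumes "unitary_constants \<U>"
    and "qubit X q"
    and "well_formed X \<U> B" and "qv B = {q}"
    and "well_formed X \<U> C0" and "q \<notin> qv C0"
    and "well_formed X \<U> C1" and "q \<notin> qv C1"
    and "well_formed X \<U> D0" and "q \<notin> qv D0"
    and "well_formed X \<U> D1" and "q \<notin> qv D1"
    and "well_formed X \<U> C"
    and "orthonormal_basis (listset [X q]) [\<phi>0, \<phi>1]"
  shows
    \<comment> \<open>symmetry\<close>
    "(NOT_gate \<in> \<U> \<longrightarrow>
       circuit_equiv X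
         (pre_choice (Gate NOT_gate [q]) q (ket [0]) (ket [1]) C0 C1)
         (post_choice (Gate NOT_gate [q]) q (ket [0]) (ket [1]) C1 C0)) \<and>
     (\<forall>U\<in>\<U>. \<forall>\<psi>0 \<psi>1 l0 l1.
       utype U = [X q] \<longrightarrow>
       orthonormal_basis (listset [X q]) [\<psi>0, \<psi>1] \<longrightarrow>
       uop U \<phi>0 = (\<lambda>x. l0 * \<psi>0 x) \<longrightarrow>
       uop U \<phi>1 = (\<lambda>x. l1 * \<psi>1 x) \<longrightarrow>
       circuit_equiv X
         (pre_choice (Gate U [q]) q \<psi>0 \<psi>1 C0 C1)
         (post_choice (Gate U [q]) q \<phi>0 \<phi>1 C0 C1)) \<and>
     \<comment> \<open>sequentiality\<close>
     circuit_equiv X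
       (Seq (pre_choice B q \<phi>0 \<phi>1 C0 C1) (choice q \<phi>0 \<phi>1 D0 D1))
       (pre_choice B q \<phi>0 \<phi>1 (Seq C0 D0) (Seq C1 D1)) \<and>
     circuit_equiv X
       (Seq (choice q \<phi>0 \<phi>1 C0 C1) (post_choice B q \<phi>0 \<phi>1 D0 D1))
       (post_choice B q \<phi>0 \<phi>1 (Seq C0 D0) (Seq C1 D1)) \<and>
     \<comment> \<open>distributivity\<close>
     (q \<notin> qv C \<longrightarrow>
       circuit_equiv X
         (Seq C (pre_choice B q \<phi>0 \<phi>1 C0 C1))
         (pre_choice B q \<phi>0 \<phi>1 (Seq C C0) (Seq C C1)) \<and>
       circuit_equiv X
         (Seq (pre_choice B q \<phi>0 \<phi>1 C0 C1) C)
         (pre_choice B q \<phi>0 \<phi>1 (Seq C0 C) (Seq C1 C)) \<and>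
       circuit_equiv X
         (Seq C (post_choice B q \<phi>0 \<phi>1 C0 C1))
         (post_choice B q \<phi>0 \<phi>1 (Seq C C0) (Seq C C1)) \<and>
       circuit_equiv X
         (Seq (post_choice B q \<phi>0 \<phi>1 C0 C1) C)
         (post_choice B q \<phi>0 \<phi>1 (Seq C0 C) (Seq C1 C)))"
proof -
  note \<U> = assms(1) and q = assms(2) and wfB = assms(3) and qvB = assms(4)
  note wf = assms(5,7,9,11,13) and nq = assms(6,8,10,12) and onb = assms(14)
  let ?H = "\<lambda>V. ell2 (PiE V X)"
  have B: "sem_on X V B f \<in> ?H V" if "f \<in> ?H V" "q \<in> V" for V f
    using that qvB by (intro bounded_op_ell2[OF bounded_op_sem_on[OF \<U> wfB]]) auto
  have comm: "sem_on X V C (sem_on X V B f) = sem_on X V B (sem_on X V C f)"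
    if "q \<notin> qv C" "insert q (qv C) \<subseteq> V" "f \<in> ?H V" for V f
    using that qvB finite_qubit[OF q] by (intro sem_on_commute[OF \<U> wf(5) _ wfB]) auto
  note simps = pre_choice_def post_choice_def sem_on_Seq qv_choice qvB
  \<comment> \<open>The input basis is kept general, so that the NOT gate can be treated with the
    computational basis in place of \<open>\<phi>0\<close>, \<open>\<phi>1\<close>.\<close>
  have sym: "circuit_equiv X (pre_choice (Gate U [q]) q \<psi>0 \<psi>1 C0 C1)
      (post_choice (Gate U [q]) q \<theta>0 \<theta>1 C0 C1)"
    if "U \<in> \<U>" "utype U = [X q]" "orthonormal_basis (listset [X q]) [\<theta>0, \<theta>1]"
      "orthonormal_basis (listset [X q]) [\<psi>0, \<psi>1]"
      "uop U \<theta>0 = (\<lambda>x. l0 * \<psi>0 x)" "uop U \<theta>1 = (\<lambda>x. l1 * \<psi>1 x)" for U \<theta>0 \<theta>1 \<psi>0 \<psi>1 l0 l1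
  proof (rule circuit_equivI[where V = "{q} \<union> qv C0 \<union> qv C1"])
    fix f assume f: "f \<in> ?H ({q} \<union> qv C0 \<union> qv C1)"
    show "sem_on X ({q} \<union> qv C0 \<union> qv C1) (pre_choice (Gate U [q]) q \<psi>0 \<psi>1 C0 C1) f
        = sem_on X ({q} \<union> qv C0 \<union> qv C1) (post_choice (Gate U [q]) q \<theta>0 \<theta>1 C0 C1) f"
      using choice_symmetry[OF \<U> q that(3,4,1,2,5,6) wf(1,2) subset_refl nq(1,2) f]
      by (simp add: simps subset_iff)
  qed (auto simp: simps)
  have NOT: "circuit_equiv X (pre_choice (Gate NOT_gate [q]) q (ket [0]) (ket [1]) C0 C1)
      (post_choice (Gate NOT_gate [q]) q (ket [0]) (ket [1]) C1 C0)" if N: "NOT_gate \<in> \<U>"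
  proof -
    have L: "listset [X q] = {[0], [1]}" "utype NOT_gate = [X q]"
      using q by (auto simp: qubit_def NOT_gate_def set_Cons_def)
    have basis: "orthonormal_basis {[0], [1]} [ket [0], ket [1::'b]]"
      "orthonormal_basis {[0], [1]} [ket [1], ket [0::'b]]"
      using orthonormal_basis_kets[of "[0]" "[1::'b]"] orthonormal_basis_kets[of "[1]" "[0::'b]"]
      by (simp_all add: insert_commute)
    \<comment> \<open>NOT exchanges the kets, so the general law applies with the input basis in
      reversed order and both scalars equal to 1.\<close>
    have "uop NOT_gate (ket [1]) = (\<lambda>x. 1 * ket [0::'b] x)" "uop NOT_gate (ket [0]) = (\<lambda>x. 1 * ket [1::'b] x)"
      by (auto simp: NOT_gate_def ket_def fun_eq_iff)
    from sym[OF N L(2) _ _ this] have "circuit_equiv X (pre_choice (Gate NOT_gate [q]) q (ket [0]) (ket [1]) C0 C1)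
      (post_choice (Gate NOT_gate [q]) q (ket [1]) (ket [0]) C0 C1)"
      using basis by (simp only: L)
    \<comment> \<open>Listing the two branches in the other order restores the standard order of the
      kets and exchanges \<open>C0\<close> with \<open>C1\<close>.\<close>
    moreover have "circuit_equiv X (post_choice (Gate NOT_gate [q]) q (ket [1]) (ket [0]) C0 C1)
        (post_choice (Gate NOT_gate [q]) q (ket [0]) (ket [1]) C1 C0)"
      by (rule circuit_equivI[where V = "{q} \<union> qv C0 \<union> qv C1"])
        (auto simp: simps sem_on_choice_swap[of q "ket [1]"] subset_iff)
    \<comment> \<open>The three circuits have the same variables, so both equivalences are
      equalities on one space and can be chained.\<close>
    ultimately show ?thesis
      by (simp add: circuit_equiv_def post_choice_def pre_choice_def qv_choice Un_ac)
  qed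
  have seq1: "circuit_equiv X
       (Seq (pre_choice B q \<phi>0 \<phi>1 C0 C1) (choice q \<phi>0 \<phi>1 D0 D1))
       (pre_choice B q \<phi>0 \<phi>1 (Seq C0 D0) (Seq C1 D1))" (is "circuit_equiv X ?l ?r")
  proof (rule circuit_equivI[where V = "qv ?l"])
    let ?V = "qv ?l"
    fix f assume "f \<in> ?H ?V"
    then have "sem_on X ?V B f \<in> ?H ?V"
      by (rule B) (simp add: simps)
    \<comment> \<open>\<open>B\<close> acts first on both sides, so the law for consecutive choices
      is applied to the image of \<open>f\<close> under \<open>B\<close>.\<close>
    from choice_Seq_choice[OF \<U> q onb wf(1-4) _ nq(3,4) this]
    show "sem_on X ?V ?l f = sem_on X ?V ?r f"
      by (simp add: simps subset_iff)
  qed (auto simp: simps)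
  have seq2: "circuit_equiv X
       (Seq (choice q \<phi>0 \<phi>1 C0 C1) (post_choice B q \<phi>0 \<phi>1 D0 D1))
       (post_choice B q \<phi>0 \<phi>1 (Seq C0 D0) (Seq C1 D1))" (is "circuit_equiv X ?l ?r")
  proof (rule circuit_equivI[where V = "qv ?l"])
    let ?V = "qv ?l"
    fix f assume "f \<in> ?H ?V"
    \<comment> \<open>\<open>B\<close> acts last on both sides, so the law is applied to
      \<open>f\<close> itself.\<close>
    from choice_Seq_choice[OF \<U> q onb wf(1-4) _ nq(3,4) this]
    show "sem_on X ?V ?l f = sem_on X ?V ?r f"
      by (simp add: simps subset_iff)
  qed (auto simp: simps)
  have dist1: "circuit_equiv X
         (Seq C (pre_choice B q \<phi>0 \<phi>1 C0 C1))
         (pre_choice B q \<phi>0 \<phi>1 (Seq C C0) (Seq C C1))" (is "circuit_equiv X ?l ?r")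
    if "q \<notin> qv C"
  proof (rule circuit_equivI[where V = "qv ?l"])
    let ?V = "qv ?l"
    fix f assume "f \<in> ?H ?V"
    \<comment> \<open>\<open>C\<close> is moved past \<open>B\<close>; standing directly before the
      choice, it becomes the first step of both branches.\<close>
    from comm[OF that _ this] show "sem_on X ?V ?l f = sem_on X ?V ?r f"
      by (simp add: simps choice_Seq_left subset_iff)
  qed (auto simp: simps)
  have dist2: "circuit_equiv X
         (Seq (pre_choice B q \<phi>0 \<phi>1 C0 C1) C)
         (pre_choice B q \<phi>0 \<phi>1 (Seq C0 C) (Seq C1 C))" (is "circuit_equiv X ?l ?r")
    if "q \<notin> qv C"
  proof (rule circuit_equivI[where V = "qv ?l"])
    let ?V = "qv ?l"
    fix f assume "f \<in> ?H ?V"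
    then have "sem_on X ?V B f \<in> ?H ?V"
      by (rule B) (simp add: simps)
    from choice_Seq_right[OF \<U> q onb wf(1,2,5) _ that this]
    show "sem_on X ?V ?l f = sem_on X ?V ?r f"
      by (simp add: simps subset_iff)
  qed (auto simp: simps)
  have dist3: "circuit_equiv X
         (Seq C (post_choice B q \<phi>0 \<phi>1 C0 C1))
         (post_choice B q \<phi>0 \<phi>1 (Seq C C0) (Seq C C1))" (is "circuit_equiv X ?l ?r")
    by (rule circuit_equivI[where V = "qv ?l"]) (auto simp: simps choice_Seq_left subset_iff)
  have dist4: "circuit_equiv X
         (Seq (post_choice B q \<phi>0 \<phi>1 C0 C1) C)
         (post_choice B q \<phi>0 \<phi>1 (Seq C0 C) (Seq C1 C))" (is "circuit_equiv X ?l ?r")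
    if "q \<notin> qv C"
  proof (rule circuit_equivI[where V = "qv ?l"])
    let ?V = "qv ?l" and ?c = "choice q \<phi>0 \<phi>1 C0 C1"
    fix f assume f: "f \<in> ?H ?V"
    \<comment> \<open>Well-formedness makes the output of the choice square-summable, as the
      commutation of \<open>C\<close> with \<open>B\<close> demands of its argument.\<close>
    have "well_formed X \<U> ?c"
      using wf nq onb by (simp add: choice_def)
    then have "sem_on X ?V ?c f \<in> ?H ?V"
      by (rule bounded_op_ell2[OF bounded_op_sem_on[OF \<U>] f]) (auto simp: simps)
    \<comment> \<open>\<open>C\<close> first passes the final \<open>B\<close> and then enters the
      branches as their last step.\<close>
    from comm[OF that _ this] choice_Seq_right[OF \<U> q onb wf(1,2,5) _ that f]
    show "sem_on X ?V ?l f = sem_on X ?V ?r f"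
      by (simp add: simps subset_iff)
  qed (auto simp: simps)
  show ?thesis
    using sym[OF _ _ onb] NOT seq1 seq2 dist1 dist2 dist3 dist4 by blast
qed

end
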